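(* Let $\Gamma=(X,A)$, $\delta X\subsetneq X$, $w$, $V$, $\mathcal{M}_V$, $\chi$ be as in the context, and enumerate $X\setminus\delta X=\{u_1,\dots,u_n\}$. Let $z\in\mathbb{C}$ be such that $\chi\mathcal{M}_V\chi^*-zI$ is invertible, and put $G_z=(\chi\mathcal{M}_V\chi^*-zI)^{-1}$, a matrix indexed by $X\setminus\delta X$. Then $\iota_1(z;\mathcal{H}_L(\Gamma;\delta X))\neq 0$, $\iota_1(z;\mathcal{H}_Q(\Gamma;\delta X))\neq 0$, and for all $u_\ell,u_m\in X\setminus\delta X$ (equal or not), $$G_z(u_\ell,u_m)=\frac{\iota_2(z;\mathcal{H}_L(\Gamma;\delta X;\ell,m))}{\iota_1(z;\mathcal{H}_L(\Gamma;\delta X))}=\frac{\iota_2(z;\mathcal{H}_Q(\Gamma;\delta X;\ell,m))}{\iota_1(z;\mathcal{H}_Q(\Gamma;\delta X))}.$$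
   Context: Setting. $\Gamma=(X,A)$ is a finite connected symmetric digraph: each arc $a\in A$ has an origin $o(a)$ and a terminus $t(a)$, and there is a distinguished inverse arc $\bar a\in A$ with $o(\bar a)=t(a)$, $t(\bar a)=o(a)$, $\bar{\bar a}=a$; multiple arcs are allowed, self-loops are not. The undirected edge supporting $a$ is $|a|=|\bar a|$, and $E=\{|a|:a\in A\}$ (a multigraph edge set). A boundary $\delta X\subsetneq X$ (possibly empty) is fixed. Given an edge weight $w:E\to\mathbb{C}$ and a potential $V:X\to\mathbb{C}$, define $(Mf)(u)=\sum_{a\in A,\,t(a)=u}w(|a|)f(o(a))$ for $f\in\mathbb{C}^X$, and $\mathcal{M}_V=M+V$, where $V$ acts by multiplication $(Vf)(u)=V(u)f(u)$. $\chi:\mathbb{C}^X\to\mathbb{C}^{X\setminus\delta X}$ is restriction and $\chi^*$ is extension by zero, so $\chi\mathcal{M}_V\chi^*$ is the principal submatrix of $\mathcal{M}_V$ indexed by $X\setminus\delta X$. Put $\pi(u)=\sum_{a\in A,\,t(a)=u}w(|a|)$. Deformed graph. $\mathring\Gamma$ is the undirected multigraph with vertex set $X$ and edge set $E\cup S$, where $S=\{\sigma_u:u\in X\setminus\delta X\}$ and $\sigma_u$ is a new self-loop at $u$. A spanning subgraph of $\mathring\Gamma$ has vertex set $X$ and edge set a subset of $E\cup S$; $S(H)$ denotes its self-loops. A self-loop counts as a cycle of length $1$ (two parallel edges form a cycle of length 2). A tree is a connected graph with no cycle (in particular no self-loop; an isolated vertex is a tree). An odd unicyclic graph is a connected graph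 containing exactly one cycle, of odd length (a tree with exactly one self-loop attached is odd unicyclic). Families of spanning subgraphs. For $J\in\{L,Q\}$, $\mathcal{H}_J(\Gamma;\delta X)$ is the set of spanning subgraphs $H$ of $\mathring\Gamma$ such that every connected component $W$ of $H$ satisfies: (i) if $W$ contains a vertex of $\delta X$, then it contains exactly one vertex of $\delta X$ and $W$ is a tree; (ii) otherwise, for $J=L$, $W$ is a tree together with exactly one self-loop, and for $J=Q$, $W$ is odd unicyclic. For $u_\ell,u_m\in X\setminus\delta X$ (possibly equal), $\mathcal{H}_J(\Gamma;\delta X;\ell,m)$ is the set of spanning subgraphs $H$ of $\mathring\Gamma$ such that every component $W$ satisfies: (i)' if $W$ contains a vertex of $\delta X$, then it contains exactly one, contains neither $u_\ell$ nor $u_m$, and is a tree; (ii)' if $W$ contains $u_\ell$ or $u_m$, then it contains both, contains no vertex of $\delta X$, and is a tree (no self-loop); (iii)' otherwise, for $J=L$, $W$ is a tree with exactly one self-loop, and for $J=Q$, $W$ is odd unicyclic. Weights. For $z\in\mathbb{C}$: $w_L(z;e)=-w(e)$ and $w_Q(z;e)=w(e)$ for $e\in E$; $w_L(z;\sigma_u)=-z+V(u)+\pi(u)$ and $w_Q(z;\sigma_u)=-z+V(u)-\pi(u)$ for $u\in X\setminus\delta X$. For a subgraph $H$, $W_J(z;H)=\prod_{e\in E(H)}w_J(z;e)$ (product over all edges of $H$ including self-loops). Let $b(H)$ be the number of connected components of $H$ containing a cycle of length $\ge 3$, and for $H\in\mathcal{H}_Q(\Gamma;\delta X;\ell,m)$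 let $\mathrm{dist}_H(u_\ell,u_m)$ be the graph distance in $H$ (they lie in a common tree). Define $\iota_1(z;\mathcal{H}_L(\Gamma;\delta X))=\sum_{H\in\mathcal{H}_L(\Gamma;\delta X)}W_L(z;H)$, $\iota_1(z;\mathcal{H}_Q(\Gamma;\delta X))=\sum_{H\in\mathcal{H}_Q(\Gamma;\delta X)}4^{b(H)}W_Q(z;H)$, $\iota_2(z;\mathcal{H}_L(\Gamma;\delta X;\ell,m))=\sum_{H\in\mathcal{H}_L(\Gamma;\delta X;\ell,m)}W_L(z;H)$, $\iota_2(z;\mathcal{H}_Q(\Gamma;\delta X;\ell,m))=\sum_{H\in\mathcal{H}_Q(\Gamma;\delta X;\ell,m)}4^{b(H)}(-1)^{\mathrm{dist}_H(u_\ell,u_m)}W_Q(z;H)$. *)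

theory Defs
  imports Complex_Main
begin

section \<open>Generic multigraphs given by an endpoint map\<close>

text \<open>An edge e has endpoint set ends e (a singleton for a self-loop).\<close>

definition adj :: "('e \<Rightarrow> 'v set) \<Rightarrow> 'e set \<Rightarrow> ('v \<times> 'v) set" where
  "adj ends F = {(x, y). \<exists>e\<in>F. ends e = {x, y}}"

text \<open>Vertex sets of the connected components of the graph (C, F).\<close>
definition components :: "('e \<Rightarrow> 'v set) \<Rightarrow> 'v set \<Rightarrow> 'e set \<Rightarrow> 'v set set" where
  "components ends C F = {{y \<in> C. (x, y) \<in> (adj ends F)\<^sup>*} | x. x \<in> C}"

text \<open>Edges of the component with vertex set W.\<close>
definition comp_edges :: "('e \<Rightarrow> 'v set) \<Rightarrow> 'e set \<Rightarrow> 'v set \<Rightarrow> 'e set" where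
  "comp_edges ends F W = {e \<in> F. ends e \<subseteq> W}"

text \<open>A cycle (given by its edge set) of length k = number of its edges:
  distinct edges e_0..e_(k-1), distinct vertices v_0..v_(k-1), e_i joins v_i and v_(i+1 mod k).
  k = 1 is a self-loop, k = 2 is a pair of parallel edges.\<close>
definition is_cycle :: "('e \<Rightarrow> 'v set) \<Rightarrow> 'e set \<Rightarrow> 'e set \<Rightarrow> bool" where
  "is_cycle ends F Cy \<longleftrightarrow> (\<exists>vs es. es \<noteq> [] \<and> length vs = length es \<and> distinct vs \<and> distinct es
      \<and> set es \<subseteq> F \<and> set es = Cy
      \<and> (\<forall>i < length es. ends (es ! i) = {vs ! i, vs ! (Suc i mod length es)}))"

definition connected_graph :: "('e \<Rightarrow> 'v set) \<Rightarrow> 'v set \<Rightarrow> 'e set \<Rightarrow> bool" where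
  "connected_graph ends W F \<longleftrightarrow> W \<noteq> {} \<and> (\<forall>x\<in>W. \<forall>y\<in>W. (x, y) \<in> (adj ends F)\<^sup>*)"

definition is_tree :: "('e \<Rightarrow> 'v set) \<Rightarrow> 'v set \<Rightarrow> 'e set \<Rightarrow> bool" where
  "is_tree ends W F \<longleftrightarrow> connected_graph ends W F \<and> \<not> (\<exists>Cy. is_cycle ends F Cy)"

definition is_loop :: "('e \<Rightarrow> 'v set) \<Rightarrow> 'e \<Rightarrow> bool" where
  "is_loop ends e \<longleftrightarrow> card (ends e) = 1"

text \<open>A tree together with exactly one self-loop.\<close>
definition tree_one_loop :: "('e \<Rightarrow> 'v set) \<Rightarrow> 'v set \<Rightarrow> 'e set \<Rightarrow> bool" where
  "tree_one_loop ends W F \<longleftrightarrow> card {e \<in> F. is_loop ends e} = 1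
      \<and> is_tree ends W {e \<in> F. \<not> is_loop ends e}"

definition odd_unicyclic :: "('e \<Rightarrow> 'v set) \<Rightarrow> 'v set \<Rightarrow> 'e set \<Rightarrow> bool" where
  "odd_unicyclic ends W F \<longleftrightarrow> connected_graph ends W F \<and> (\<exists>!Cy. is_cycle ends F Cy)
      \<and> (\<forall>Cy. is_cycle ends F Cy \<longrightarrow> odd (card Cy))"

definition gdist :: "('e \<Rightarrow> 'v set) \<Rightarrow> 'e set \<Rightarrow> 'v \<Rightarrow> 'v \<Rightarrow> nat" where
  "gdist ends F x y = (LEAST n. (x, y) \<in> (adj ends F) ^^ n)"

section \<open>Symmetric digraphs and the deformed graph\<close>

definition symmetric_digraph ::
  "'v set \<Rightarrow> 'a set \<Rightarrow> ('a \<Rightarrow> 'v) \<Rightarrow> ('a \<Rightarrow> 'v) \<Rightarrow> ('a \<Rightarrow> 'a) \<Rightarrow> bool" where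
  "symmetric_digraph X A org tgt rv \<longleftrightarrow> finite X \<and> finite A
     \<and> (\<forall>a\<in>A. org a \<in> X \<and> tgt a \<in> X \<and> rv a \<in> A \<and> org (rv a) = tgt a \<and> tgt (rv a) = org a
              \<and> rv (rv a) = a \<and> org a \<noteq> tgt a)
     \<and> (\<forall>x\<in>X. \<forall>y\<in>X. (x, y) \<in> {(org a, tgt a) | a. a \<in> A}\<^sup>*)"

text \<open>Undirected edge |a| supporting arc a.\<close>
definition uedge :: "('a \<Rightarrow> 'a) \<Rightarrow> 'a \<Rightarrow> 'a set" where
  "uedge rv a = {a, rv a}"

definition uedges :: "'a set \<Rightarrow> ('a \<Rightarrow> 'a) \<Rightarrow> 'a set set" where
  "uedges A rv = uedge rv ` A"

text \<open>Edges of the deformed graph: ordinary edges and the new self-loops sigma_u.\<close>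
datatype ('v, 'a) dedge = DE "'a set" | DL 'v

fun dends :: "('a \<Rightarrow> 'v) \<Rightarrow> ('a \<Rightarrow> 'v) \<Rightarrow> ('v, 'a) dedge \<Rightarrow> 'v set" where
  "dends org tgt (DE e) = (\<Union>a\<in>e. {org a, tgt a})"
| "dends org tgt (DL u) = {u}"

definition deformed_edges ::
  "'v set \<Rightarrow> 'v set \<Rightarrow> 'a set \<Rightarrow> ('a \<Rightarrow> 'a) \<Rightarrow> ('v, 'a) dedge set" where
  "deformed_edges X dX A rv = DE ` uedges A rv \<union> DL ` (X - dX)"

datatype jtype = JL | JQ

definition Jcond :: "jtype \<Rightarrow> ('e \<Rightarrow> 'v set) \<Rightarrow> 'v set \<Rightarrow> 'e set \<Rightarrow> bool" where
  "Jcond J ends W F = (case J of JL \<Rightarrow> tree_one_loop ends W F | JQ \<Rightarrow> odd_unicyclic ends W F)"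

text \<open>The family H_J(Gamma; dX).\<close>
definition HJ1 :: "jtype \<Rightarrow> 'v set \<Rightarrow> 'v set \<Rightarrow> 'a set \<Rightarrow> ('a \<Rightarrow> 'v) \<Rightarrow> ('a \<Rightarrow> 'v) \<Rightarrow> ('a \<Rightarrow> 'a)
    \<Rightarrow> ('v, 'a) dedge set set" where
  "HJ1 J X dX A org tgt rv = {H. H \<subseteq> deformed_edges X dX A rv \<and>
     (\<forall>W \<in> components (dends org tgt) X H.
        (W \<inter> dX \<noteq> {} \<longrightarrow> card (W \<inter> dX) = 1 \<and> is_tree (dends org tgt) W (comp_edges (dends org tgt) H W))
      \<and> (W \<inter> dX = {} \<longrightarrow> Jcond J (dends org tgt) W (comp_edges (dends org tgt) H W)))}"

text \<open>The family H_J(Gamma; dX; l, m), with ul, um the vertices u_l, u_m.\<close>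
definition HJ2 :: "jtype \<Rightarrow> 'v set \<Rightarrow> 'v set \<Rightarrow> 'a set \<Rightarrow> ('a \<Rightarrow> 'v) \<Rightarrow> ('a \<Rightarrow> 'v) \<Rightarrow> ('a \<Rightarrow> 'a)
    \<Rightarrow> 'v \<Rightarrow> 'v \<Rightarrow> ('v, 'a) dedge set set" where
  "HJ2 J X dX A org tgt rv ul um = {H. H \<subseteq> deformed_edges X dX A rv \<and>
     (\<forall>W \<in> components (dends org tgt) X H.
        (W \<inter> dX \<noteq> {} \<longrightarrow> card (W \<inter> dX) = 1 \<and> ul \<notin> W \<and> um \<notin> W
            \<and> is_tree (dends org tgt) W (comp_edges (dends org tgt) H W))
      \<and> ((ul \<in> W \<or> um \<in> W) \<longrightarrow> ul \<in> W \<and> um \<in> W \<and> W \<inter> dX = {}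
            \<and> is_tree (dends org tgt) W (comp_edges (dends org tgt) H W))
      \<and> ((W \<inter> dX = {} \<and> ul \<notin> W \<and> um \<notin> W) \<longrightarrow> Jcond J (dends org tgt) W (comp_edges (dends org tgt) H W)))}"

section \<open>Weights\<close>

definition piw :: "'a set \<Rightarrow> ('a \<Rightarrow> 'v) \<Rightarrow> ('a \<Rightarrow> 'a) \<Rightarrow> ('a set \<Rightarrow> complex) \<Rightarrow> 'v \<Rightarrow> complex" where
  "piw A tgt rv w u = (\<Sum>a \<in> {a \<in> A. tgt a = u}. w (uedge rv a))"

fun wJ :: "jtype \<Rightarrow> 'a set \<Rightarrow> ('a \<Rightarrow> 'v) \<Rightarrow> ('a \<Rightarrow> 'a) \<Rightarrow> ('a set \<Rightarrow> complex) \<Rightarrow> ('v \<Rightarrow> complex)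
    \<Rightarrow> complex \<Rightarrow> ('v, 'a) dedge \<Rightarrow> complex" where
  "wJ JL A tgt rv w V z (DE e) = - w e"
| "wJ JQ A tgt rv w V z (DE e) = w e"
| "wJ JL A tgt rv w V z (DL u) = - z + V u + piw A tgt rv w u"
| "wJ JQ A tgt rv w V z (DL u) = - z + V u - piw A tgt rv w u"

definition WJ :: "jtype \<Rightarrow> 'a set \<Rightarrow> ('a \<Rightarrow> 'v) \<Rightarrow> ('a \<Rightarrow> 'a) \<Rightarrow> ('a set \<Rightarrow> complex) \<Rightarrow> ('v \<Rightarrow> complex)
    \<Rightarrow> complex \<Rightarrow> ('v, 'a) dedge set \<Rightarrow> complex" where
  "WJ J A tgt rv w V z H = (\<Prod>e \<in> H. wJ J A tgt rv w V z e)"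

text \<open>b(H): number of components containing a cycle of length at least 3.\<close>
definition bnum :: "'v set \<Rightarrow> ('a \<Rightarrow> 'v) \<Rightarrow> ('a \<Rightarrow> 'v) \<Rightarrow> ('v, 'a) dedge set \<Rightarrow> nat" where
  "bnum X org tgt H = card {W \<in> components (dends org tgt) X H.
       \<exists>Cy. is_cycle (dends org tgt) (comp_edges (dends org tgt) H W) Cy \<and> card Cy \<ge> 3}"

definition iota1 :: "jtype \<Rightarrow> 'v set \<Rightarrow> 'v set \<Rightarrow> 'a set \<Rightarrow> ('a \<Rightarrow> 'v) \<Rightarrow> ('a \<Rightarrow> 'v) \<Rightarrow> ('a \<Rightarrow> 'a)
    \<Rightarrow> ('a set \<Rightarrow> complex) \<Rightarrow> ('v \<Rightarrow> complex) \<Rightarrow> complex \<Rightarrow> complex" where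
  "iota1 J X dX A org tgt rv w V z =
     (\<Sum>H \<in> HJ1 J X dX A org tgt rv.
        (case J of JL \<Rightarrow> 1 | JQ \<Rightarrow> 4 ^ bnum X org tgt H) * WJ J A tgt rv w V z H)"

definition iota2 :: "jtype \<Rightarrow> 'v set \<Rightarrow> 'v set \<Rightarrow> 'a set \<Rightarrow> ('a \<Rightarrow> 'v) \<Rightarrow> ('a \<Rightarrow> 'v) \<Rightarrow> ('a \<Rightarrow> 'a)
    \<Rightarrow> ('a set \<Rightarrow> complex) \<Rightarrow> ('v \<Rightarrow> complex) \<Rightarrow> complex \<Rightarrow> 'v \<Rightarrow> 'v \<Rightarrow> complex" where
  "iota2 J X dX A org tgt rv w V z ul um =
     (\<Sum>H \<in> HJ2 J X dX A org tgt rv ul um.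
        (case J of JL \<Rightarrow> 1
           | JQ \<Rightarrow> 4 ^ bnum X org tgt H * (-1) ^ gdist (dends org tgt) H ul um)
        * WJ J A tgt rv w V z H)"

section \<open>The matrix M_V\<close>

text \<open>(M_V)(u,v) = sum of w(|a|) over arcs a with t(a) = u, o(a) = v, plus V(u) on the diagonal.\<close>
definition MV :: "'a set \<Rightarrow> ('a \<Rightarrow> 'v) \<Rightarrow> ('a \<Rightarrow> 'v) \<Rightarrow> ('a \<Rightarrow> 'a) \<Rightarrow> ('a set \<Rightarrow> complex)
    \<Rightarrow> ('v \<Rightarrow> complex) \<Rightarrow> 'v \<Rightarrow> 'v \<Rightarrow> complex" where
  "MV A org tgt rv w V u v =
     (\<Sum>a \<in> {a \<in> A. tgt a = u \<and> org a = v}. w (uedge rv a)) + (if u = v then V u else 0)"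

end

theory Submission
  imports Defs "HOL-Combinatorics.Orbits" "HOL-Library.FuncSet" "HOL-Library.Disjoint_Sets"
begin

text \<open>
  Up to the sign \<epsilon> = -1 (for L) or \<epsilon> = 1 (for Q), row u of the matrix is a sum over the edges at u
  of the edge weight times the row "1 at u, \<epsilon> at the other end". Expanding the determinant in all rows
  gives a sum over choices f of one incident edge per non-boundary vertex. Such a choice is a functional
  graph, and its determinant is the product over the nontrivial cycles of 1 - (-\<epsilon>)^k, where k is the
  length, i.e. 0 or 2. The choices with nonzero contribution have as image exactly the spanning subgraphs
  of the family, and each H is hit once for every orientation of its long cycles. Hence each long cycle
  contributes 2 * 2 = 4.

  For the numerator, Cramer's rule replaces row m by the unit row of l. This turns m into a further
  root. Pushing the unit vector along the path from l contributes a factor -\<epsilon> per step until the path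
  reaches m, and the determinant vanishes if it never does.
\<close>

section \<open>Determinants over a finite index set\<close>

text \<open>The summand \<open>piw\<close> of the loop weights makes the rows come out right: every
  edge at a vertex also puts its signed weight on the diagonal, and the loop weight takes this total
  away again. The obstacle is that independent choices may let two vertices pick the same edge, so
  that a choice need not orient a subgraph. Such a pair is a 2-cycle of the functional graph, and 1
  - (-\<epsilon>)^2 = 0 for both signs, so only injective choices survive. For an injective choice
  every component of the image contains exactly one periodic orbit (a root, a self-loop or a longer
  cycle), which turns the conditions on components into conditions on orbit lengths. A fixed point
  contributes a plain 1; this is why self-loops are admissible for L although 1 - (-\<epsilon>)^k
  vanishes there at k = 1. Distances enter only through their parity, because -\<epsilon> is 1 or
  -1.\<close>

definition det_on :: "'v set \<Rightarrow> ('v \<Rightarrow> 'v \<Rightarrow> 'a::comm_ring_1) \<Rightarrow> 'a" where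
  "det_on X M = (\<Sum>\<sigma> | \<sigma> permutes X. of_int (sign \<sigma>) * (\<Prod>u\<in>X. M u (\<sigma> u)))"

lemma det_on_cong:
  assumes "\<And>u v. u \<in> X \<Longrightarrow> v \<in> X \<Longrightarrow> M u v = N u v"
  shows "det_on X M = det_on X N"
  unfolding det_on_def
  by (intro sum.cong refl arg_cong2[where f="(*)"] prod.cong) (auto simp: assms permutes_in_image)

lemma det_on_only_id:
  assumes "finite X" and diag: "\<And>u. u \<in> X \<Longrightarrow> u \<noteq> a \<Longrightarrow> M u u = 1"
    and other: "\<And>\<sigma>. \<sigma> permutes X \<Longrightarrow> \<sigma> \<noteq> id \<Longrightarrow> \<exists>u\<in>X. M u (\<sigma> u) = 0"
  shows "det_on X M = (if a \<in> X then M a a else 1)"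
proof -
  have "det_on X M = (\<Sum>\<sigma> | \<sigma> permutes X. if \<sigma> = id then (\<Prod>u\<in>X. M u u) else 0)"
    unfolding det_on_def
  proof (intro sum.cong refl, goal_cases)
    case (1 \<sigma>)
    have "(\<Prod>u\<in>X. M u (\<sigma> u)) = 0" if "\<sigma> \<noteq> id"
      using other[of \<sigma>] that 1 by (intro prod_zero[OF assms(1)]) simp
    then show ?case by auto
  qed
  also have "\<dots> = (\<Prod>u\<in>X. M u u)"
    using assms(1) by (simp add: sum.delta finite_permutations permutes_id)
  also have "\<dots> = (if a \<in> X then M a a else 1)"
  proof (cases "a \<in> X")
    case True
    have "(\<Prod>u\<in>X - {a}. M u u) = 1" by (intro prod.neutral) (auto simp: diag)
    then show ?thesis using True assms(1) by (simp add: prod.remove)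
  next
    case False
    then show ?thesis by (auto intro!: prod.neutral diag)
  qed
  finally show ?thesis .
qed

text \<open>A permutation other than the identity moves at least two points, so it moves one besides
  \<open>a\<close>, and the unit row there contributes a zero factor.\<close>

lemma det_on_unit_rows_except:
  assumes "finite X" and unit: "\<And>u v. u \<in> X \<Longrightarrow> v \<in> X \<Longrightarrow> u \<noteq> a \<Longrightarrow> M u v = (if u = v then 1 else 0)"
  shows "det_on X M = (if a \<in> X then M a a else 1)"
proof (rule det_on_only_id[OF assms(1)])
  fix \<sigma> assume s: "\<sigma> permutes X" "\<sigma> \<noteq> id"
  have "\<exists>u. \<sigma> u \<noteq> u \<and> u \<noteq> a"
  proof (rule ccontr)
    assume c: "\<not> ?thesis"
    then have "\<sigma> u = u" if "u \<noteq> a" for u using that by auto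
    moreover from this have "\<sigma> a = a" using permutes_inj[OF s(1)] by (metis injD)
    ultimately show False using s(2) by (auto simp: fun_eq_iff) metis
  qed
  then obtain u where u: "\<sigma> u \<noteq> u" "u \<noteq> a" by blast
  then have "u \<in> X" using s(1) by (meson permutes_not_in)
  then show "\<exists>u\<in>X. M u (\<sigma> u) = 0" using u unit permutes_in_image[OF s(1)]
    by (intro bexI[of _ u]) auto
qed (simp add: unit)

text \<open>Multilinearity in the rows of \<open>U\<close> only. With \<open>U = X\<close> it yields
  the product rule, with \<open>U\<close> the non-root vertices the expansion over edge
  choices.\<close>

lemma det_on_expand_rows:
  assumes "finite X" "U \<subseteq> X" "\<And>u. u \<in> U \<Longrightarrow> finite (E u)"
    and exp: "\<And>u v. u \<in> U \<Longrightarrow> v \<in> X \<Longrightarrow> M u v = (\<Sum>e\<in>E u. c u e * K u e v)"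
  shows "det_on X M = (\<Sum>f\<in>Pi\<^sub>E U E. (\<Prod>u\<in>U. c u (f u)) * det_on X (\<lambda>u. if u \<in> U then K u (f u) else M u))"
proof -
  have fU: "finite U" using assms by (auto intro: finite_subset)
  have split: "(\<Prod>u\<in>X. g u) = (\<Prod>u\<in>U. g u) * (\<Prod>u\<in>X-U. g u)" for g :: "'a \<Rightarrow> 'c"
    using assms(1,2) by (metis mult.commute prod.subset_diff)
  have "det_on X M = (\<Sum>\<sigma> | \<sigma> permutes X. of_int (sign \<sigma>) *
      ((\<Prod>u\<in>U. \<Sum>e\<in>E u. c u e * K u e (\<sigma> u)) * (\<Prod>u\<in>X-U. M u (\<sigma> u))))"
    unfolding det_on_def split using assms(2)
    by (intro sum.cong refl arg_cong2[where f="(*)"] prod.cong)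
       (auto intro!: exp simp: permutes_in_image subset_iff)
  also have "\<dots> = (\<Sum>\<sigma> | \<sigma> permutes X. \<Sum>f\<in>Pi\<^sub>E U E. of_int (sign \<sigma>) *
      ((\<Prod>u\<in>U. c u (f u) * K u (f u) (\<sigma> u)) * (\<Prod>u\<in>X-U. M u (\<sigma> u))))"
    by (subst prod_sum_PiE) (auto simp: fU assms(3) sum_distrib_left sum_distrib_right)
  also have "\<dots> = (\<Sum>f\<in>Pi\<^sub>E U E. \<Sum>\<sigma> | \<sigma> permutes X. of_int (sign \<sigma>) *
      ((\<Prod>u\<in>U. c u (f u) * K u (f u) (\<sigma> u)) * (\<Prod>u\<in>X-U. M u (\<sigma> u))))"
    by (rule sum.swap)
  also have "\<dots> = (\<Sum>f\<in>Pi\<^sub>E U E. (\<Prod>u\<in>U. c u (f u)) * det_on X (\<lambda>u. if u \<in> U then K u (f u) else M u))"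
    unfolding det_on_def split
    by (intro sum.cong refl) (simp add: sum_distrib_left prod.distrib mult_ac)
  finally show ?thesis .
qed

lemma det_on_permute_rows:
  assumes "finite X" "q permutes X"
  shows "det_on X (\<lambda>u. M (q u)) = of_int (sign q) * det_on X M"
proof -
  have "det_on X (\<lambda>u. M (q u)) = (\<Sum>\<sigma> | \<sigma> permutes X. of_int (sign (\<sigma> \<circ> q)) * (\<Prod>u\<in>X. M (q u) ((\<sigma> \<circ> q) u)))"
    unfolding det_on_def by (rule sum_permutations_compose_right[OF assms(2)])
  also have "\<dots> = (\<Sum>\<sigma> | \<sigma> permutes X. of_int (sign q) * (of_int (sign \<sigma>) * (\<Prod>u\<in>X. M u (\<sigma> u))))"
  proof (intro sum.cong refl, goal_cases)
    case (1 \<sigma>)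
    have "permutation \<sigma>" "permutation q" using 1 assms by (auto simp: permutation_permutes)
    moreover have "(\<Prod>u\<in>X. M (q u) (\<sigma> (q u))) = (\<Prod>u\<in>X. M u (\<sigma> u))"
      using permutes_imp_bij[OF assms(2)] by (rule prod.reindex_bij_betw)
    ultimately show ?case by (simp add: sign_compose mult_ac)
  qed
  finally show ?thesis by (simp add: det_on_def sum_distrib_left)
qed

lemma det_on_equal_rows:
  fixes M :: "'v \<Rightarrow> 'v \<Rightarrow> 'a::{idom,ring_char_0}"
  assumes "finite X" "a \<in> X" "b \<in> X" "a \<noteq> b" "\<And>v. v \<in> X \<Longrightarrow> M a v = M b v"
  shows "det_on X M = 0"
proof -
  have "det_on X M = det_on X (\<lambda>u. M (transpose a b u))"
    by (rule det_on_cong) (auto simp: transpose_def assms)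
  also have "\<dots> = - det_on X M"
    using assms by (subst det_on_permute_rows) (auto simp: sign_swap_id permutes_swap_id)
  finally show ?thesis by simp
qed

text \<open>Expanding the rows of the product selects a row of \<open>M\<close> for each index.
  Repeated rows give 0, so only permutations survive, and reordering the rows brings out their
  signs.\<close>

lemma det_on_mult:
  fixes M :: "'v \<Rightarrow> 'v \<Rightarrow> 'a::{idom,ring_char_0}"
  assumes "finite X"
  shows "det_on X (\<lambda>u v. \<Sum>x\<in>X. N u x * M x v) = det_on X N * det_on X M"
proof -
  have "det_on X (\<lambda>u v. \<Sum>x\<in>X. N u x * M x v)
      = (\<Sum>g\<in>Pi\<^sub>E X (\<lambda>_. X). (\<Prod>u\<in>X. N u (g u)) * det_on X (\<lambda>u. M (g u)))"
    by (subst det_on_expand_rows[where U=X and E="\<lambda>_. X" and c=N and K="\<lambda>_ x. M x"])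
       (auto simp: assms intro!: sum.cong arg_cong2[where f="(*)"] det_on_cong)
  also have "\<dots> = (\<Sum>g\<in>(\<lambda>q. restrict q X) ` {q. q permutes X}. (\<Prod>u\<in>X. N u (g u)) * det_on X (\<lambda>u. M (g u)))"
  proof (rule sum.mono_neutral_right)
    show "finite (Pi\<^sub>E X (\<lambda>_. X))" by (simp add: assms finite_PiE)
    show "(\<lambda>q. restrict q X) ` {q. q permutes X} \<subseteq> Pi\<^sub>E X (\<lambda>_. X)" by (auto simp: permutes_in_image)
    show "\<forall>g\<in>Pi\<^sub>E X (\<lambda>_. X) - (\<lambda>q. restrict q X) ` {q. q permutes X}.
        (\<Prod>u\<in>X. N u (g u)) * det_on X (\<lambda>u. M (g u)) = 0"
    proof
      fix g assume g: "g \<in> Pi\<^sub>E X (\<lambda>_. X) - (\<lambda>q. restrict q X) ` {q. q permutes X}"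
      have "\<not> inj_on g X"
      proof
        assume "inj_on g X"
        moreover have "g ` X \<subseteq> X" using g by auto
        ultimately have "bij_betw g X X" using assms
          by (simp add: bij_betw_def endo_inj_surj)
        then have "(\<lambda>x. if x \<in> X then g x else x) permutes X"
          by (intro bij_imp_permutes) (auto cong: bij_betw_cong)
        moreover have "g = restrict (\<lambda>x. if x \<in> X then g x else x) X"
          using g by (auto simp: fun_eq_iff PiE_def extensional_def)
        ultimately show False using g by blast
      qed
      then obtain a b where "a \<in> X" "b \<in> X" "a \<noteq> b" "g a = g b" by (auto simp: inj_on_def)
      then have "det_on X (\<lambda>u. M (g u)) = 0" by (intro det_on_equal_rows[OF assms, of a b]) auto
      then show "(\<Prod>u\<in>X. N u (g u)) * det_on X (\<lambda>u. M (g u)) = 0" by simp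
    qed
  qed
  also have "\<dots> = (\<Sum>q | q permutes X. (\<Prod>u\<in>X. N u (q u)) * det_on X (\<lambda>u. M (restrict q X u)))"
  proof (subst sum.reindex)
    show "inj_on (\<lambda>q. restrict q X) {q. q permutes X}"
    proof (rule inj_onI)
      fix q r assume *: "q \<in> {q. q permutes X}" "r \<in> {q. q permutes X}" "restrict q X = restrict r X"
      show "q = r"
      proof
        fix x show "q x = r x"
          using * by (cases "x \<in> X") (metis restrict_apply', auto simp: permutes_not_in)
      qed
    qed
  qed (auto intro!: sum.cong)
  also have "\<dots> = (\<Sum>q | q permutes X. (\<Prod>u\<in>X. N u (q u)) * (of_int (sign q) * det_on X M))"
  proof (intro sum.cong refl, goal_cases)
    case (1 q)
    have "det_on X (\<lambda>u. M (restrict q X u)) = det_on X (\<lambda>u. M (q u))" by (rule det_on_cong) auto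
    then show ?case using det_on_permute_rows[OF assms, of q M] 1 by simp
  qed
  also have "\<dots> = det_on X N * det_on X M"
    by (simp add: det_on_def[of X N] sum_distrib_left sum_distrib_right mult_ac)
  finally show ?thesis .
qed

lemma det_on_row_linear:
  assumes "finite X" "a \<in> X"
  shows "det_on X (M(a := (\<lambda>v. r v + c * s v))) = det_on X (M(a := r)) + c * det_on X (M(a := s))"
proof -
  have *: "(\<Prod>u\<in>X. (M(a := t)) u (\<sigma> u)) = t (\<sigma> a) * (\<Prod>u\<in>X-{a}. M u (\<sigma> u))" for t \<sigma>
    using assms by (subst prod.remove[OF assms]) (auto intro!: arg_cong2[where f="(*)"] prod.cong)
  show ?thesis unfolding det_on_def *
    by (simp add: sum.distrib[symmetric] sum_distrib_left algebra_simps)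
qed

section \<open>Determinants of functional graphs\<close>

text \<open>Throughout, \<open>x \<in> orbit p x\<close> encodes that \<open>x\<close> is periodic,
  since \<open>orbit p x\<close> starts at \<open>p x\<close>.\<close>

lemma orbit_eq_if_mem:
  assumes "x \<in> orbit p x" "y \<in> orbit p x"
  shows "orbit p y = orbit p x"
  using assms by (blast intro: orbit_trans orbit_swap)

lemma periodic_not_fixed:
  assumes "y \<in> orbit p y" "p y \<noteq> y" "z \<in> orbit p y"
  shows "p z \<noteq> z"
  using orbit_swap[OF assms(1,3)] assms(2) orbit_eq_singleton_iff[of p z] by auto

lemma funpow_image_subset:
  assumes "p ` X \<subseteq> X" "x \<in> X"
  shows "(p ^^ n) x \<in> X"
  using assms by (induction n) auto

lemma orbit_image_subset:
  assumes "p ` X \<subseteq> X" "x \<in> X"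
  shows "orbit p x \<subseteq> X"
  using funpow_image_subset[OF assms] by (auto simp: orbit_altdef)

lemma eventually_periodic:
  assumes "finite X" "p ` X \<subseteq> X" "x \<in> X"
  shows "\<exists>i. (p ^^ i) x \<in> orbit p ((p ^^ i) x)"
proof -
  have "\<not> inj_on (\<lambda>n. (p ^^ n) x) (UNIV :: nat set)"
  proof
    assume "inj_on (\<lambda>n. (p ^^ n) x) (UNIV :: nat set)"
    moreover have "range (\<lambda>n. (p ^^ n) x) \<subseteq> X" using funpow_image_subset[OF assms(2,3)] by auto
    ultimately show False using assms(1) finite_subset finite_imageD by blast
  qed
  then obtain i j where "i < j" "(p ^^ i) x = (p ^^ j) x"
    unfolding inj_on_def by (metis linorder_neqE_nat)
  moreover have "(p ^^ (j - i)) ((p ^^ i) x) = (p ^^ (j - i + i)) x"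
    by (simp only: funpow_add o_apply)
  ultimately have "(p ^^ (j - i)) ((p ^^ i) x) = (p ^^ i) x" "0 < j - i" by auto
  then show ?thesis unfolding orbit_altdef by (metis (mono_tags, lifting) mem_Collect_eq)
qed

lemma card_orbit:
  assumes "x \<in> orbit p x"
  shows "card (orbit p x) = funpow_dist1 p x x"
  using assms by (subst orbit_conv_funpow_dist1) (auto simp: card_image inj_on_funpow_dist1)

definition unit_row :: "'v \<Rightarrow> 'v \<Rightarrow> 'a::zero_neq_one" where
  "unit_row u v = (if v = u then 1 else 0)"

text \<open>The diagonal test comes first, so a fixed point of \<open>p\<close> gets a unit row and
  not the entry 1 + \<epsilon>. Roots and self-loops thus both become unit rows; elsewhere the row
  of u is e_u + \<epsilon> e_(p u).\<close>

definition fmat :: "'a::comm_ring_1 \<Rightarrow> ('v \<Rightarrow> 'v) \<Rightarrow> 'v \<Rightarrow> 'v \<Rightarrow> 'a" where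
  "fmat \<epsilon> p u v = (if v = u then 1 else if v = p u then \<epsilon> else 0)"

text \<open>Cycles of length 1 (roots and self-loops) are excluded.\<close>

definition ncycles :: "'v set \<Rightarrow> ('v \<Rightarrow> 'v) \<Rightarrow> 'v set set" where
  "ncycles X p = {orbit p x | x. x \<in> X \<and> x \<in> orbit p x \<and> p x \<noteq> x}"

text \<open>With row \<open>a\<close> replaced by a copy of row u the determinant is 0. Since row u
  is e_u + \<epsilon> e_(p u), a unit vector e_u in row \<open>a\<close> may be exchanged for
  -\<epsilon> e_(p u). Only the rows met on the path need this form, so other rows may have been
  altered before.\<close>

lemma det_on_replace_path:
  fixes M :: "'v \<Rightarrow> 'v \<Rightarrow> 'a::{idom,ring_char_0}"
  assumes X: "finite X" "a \<in> X" "p ` X \<subseteq> X" "l \<in> X"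
    and path: "\<And>i. i < k \<Longrightarrow> (p ^^ i) l \<noteq> a" "\<And>i. i < k \<Longrightarrow> p ((p ^^ i) l) \<noteq> (p ^^ i) l"
    and agree: "\<And>i v. i < k \<Longrightarrow> M ((p ^^ i) l) v = fmat \<epsilon> p ((p ^^ i) l) v"
  shows "det_on X (M(a := unit_row l)) = (- \<epsilon>) ^ k * det_on X (M(a := unit_row ((p ^^ k) l)))"
  using path agree
proof (induction k)
  case (Suc k)
  define u where "u = (p ^^ k) l"
  have u: "u \<in> X" "u \<noteq> a" "p u \<noteq> u" using Suc.prems(1,2)[of k] funpow_image_subset[OF X(3,4)] by (auto simp: u_def)
  have "0 = det_on X (M(a := M u))"
    using u X by (intro det_on_equal_rows[of X a u, symmetric]) auto
  also have "M u = (\<lambda>v. unit_row u v + \<epsilon> * unit_row (p u) v)"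
    using Suc.prems(3)[of k] u(3) by (auto simp: u_def[symmetric] fmat_def unit_row_def)
  also have "det_on X (M(a := (\<lambda>v. unit_row u v + \<epsilon> * unit_row (p u) v)))
      = det_on X (M(a := unit_row u)) + \<epsilon> * det_on X (M(a := unit_row (p u)))"
    using X by (intro det_on_row_linear)
  finally have "det_on X (M(a := unit_row u)) = - \<epsilon> * det_on X (M(a := unit_row (p u)))"
    by (simp add: eq_neg_iff_add_eq_0)
  moreover have "det_on X (M(a := unit_row l)) = (- \<epsilon>) ^ k * det_on X (M(a := unit_row u))"
    unfolding u_def using Suc.prems by (intro Suc.IH) auto
  ultimately have "det_on X (M(a := unit_row l)) = (- \<epsilon>) ^ k * (- \<epsilon> * det_on X (M(a := unit_row (p u))))"
    by simp
  then show ?case by (simp only: u_def funpow.simps(2) o_apply power_Suc2 mult.assoc)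
qed simp

text \<open>Split row \<open>y\<close> into e_y and \<epsilon> e_(p y), and push the second unit
  vector around the rest of the cycle until it is back at \<open>y\<close>. On a cycle of length k
  this takes k - 1 steps, so the factor is 1 + \<epsilon> (-\<epsilon>)^(k-1) = 1 -
  (-\<epsilon>)^k.\<close>

lemma det_on_cycle:
  fixes M :: "'v \<Rightarrow> 'v \<Rightarrow> 'a::{idom,ring_char_0}"
  assumes X: "finite X" "p ` X \<subseteq> X" "y \<in> X" and y: "y \<in> orbit p y" "p y \<noteq> y"
    and agree: "\<And>z v. z \<in> orbit p y \<Longrightarrow> M z v = fmat \<epsilon> p z v"
  shows "det_on X M = (1 - (- \<epsilon>) ^ card (orbit p y)) * det_on X (M(y := unit_row y))"
proof -
  define k where "k = funpow_dist1 p y y"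
  have k: "(p ^^ k) y = y" "k > 0" using y by (auto simp: k_def funpow_dist1_prop simp del: funpow.simps)
  then obtain k' where k': "k = Suc k'" by (cases k) auto
  have sh: "(p ^^ i) (p y) = (p ^^ Suc i) y" for i by (simp add: funpow_swap1)
  have orb: "(p ^^ i) (p y) \<in> orbit p y" for i unfolding sh orbit_altdef using zero_less_Suc by blast
  have "det_on X M = det_on X (M(y := (\<lambda>v. unit_row y v + \<epsilon> * unit_row (p y) v)))"
    using y agree[OF y(1)] by (intro det_on_cong) (auto simp: fmat_def unit_row_def)
  also have "\<dots> = det_on X (M(y := unit_row y)) + \<epsilon> * det_on X (M(y := unit_row (p y)))"
    using X by (intro det_on_row_linear)
  also have "det_on X (M(y := unit_row (p y))) = (- \<epsilon>) ^ k' * det_on X (M(y := unit_row ((p ^^ k') (p y))))"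
  proof (rule det_on_replace_path[OF X(1,3,2)])
    show "p y \<in> X" using X by auto
    show "(p ^^ i) (p y) \<noteq> y" if "i < k'" for i
      unfolding sh using that funpow_dist1_least[of "Suc i" p y y] by (simp add: k' k_def[symmetric])
    show "p ((p ^^ i) (p y)) \<noteq> (p ^^ i) (p y)" for i
      using periodic_not_fixed[OF y orb] .
  qed (use orb agree in auto)
  also have "(p ^^ k') (p y) = y" using k by (simp add: sh k' del: funpow.simps)
  finally show ?thesis by (simp add: card_orbit[OF y(1)] k_def[symmetric] k' algebra_simps del: fun_upd_apply)
qed

lemma finite_ncycles: "finite X \<Longrightarrow> finite (ncycles X p)"
  unfolding ncycles_def by (rule finite_subset[of _ "orbit p ` X"]) auto

text \<open>An orbit that avoids \<open>y\<close> is the same for both maps, and after the change no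
  nontrivial cycle passes through \<open>y\<close>.\<close>

lemma ncycles_cut:
  assumes X: "y \<in> X" and y: "y \<in> orbit p y" "p y \<noteq> y"
  shows "ncycles X (p(y := y)) = ncycles X p - {orbit p y}"
proof (intro equalityI subsetI)
  let ?q = "p(y := y)"
  fix C assume "C \<in> ncycles X ?q"
  then obtain x where x: "C = orbit ?q x" "x \<in> X" "x \<in> orbit ?q x" "?q x \<noteq> x"
    by (auto simp: ncycles_def)
  have "y \<notin> orbit ?q x"
    using periodic_not_fixed[OF x(3,4), of y] fun_upd_same by metis
  then have C: "orbit p x = C" unfolding x(1)
    by (intro orbit_cong x) (metis fun_upd_other)
  moreover have "p x \<noteq> x" using x(4) by (auto split: if_splits)
  moreover have "x \<in> orbit p x" "C \<noteq> orbit p y" using C x(1,3) \<open>y \<notin> orbit ?q x\<close> y(1) by metis+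
  ultimately show "C \<in> ncycles X p - {orbit p y}"
    using x(2) unfolding ncycles_def by blast
next
  let ?q = "p(y := y)"
  fix C assume "C \<in> ncycles X p - {orbit p y}"
  then obtain x where x: "C = orbit p x" "x \<in> X" "x \<in> orbit p x" "p x \<noteq> x" "C \<noteq> orbit p y"
    by (auto simp: ncycles_def)
  have "y \<notin> orbit p x"
    using orbit_eq_if_mem[OF x(3), of y] x by auto
  then have C: "orbit ?q x = orbit p x"
    by (intro orbit_cong x) auto
  moreover have "?q x \<noteq> x" using x \<open>y \<notin> orbit p x\<close> by auto
  ultimately show "C \<in> ncycles X ?q"
    using x unfolding ncycles_def by auto
qed

text \<open>A point moved by \<sigma> stays moved along its \<sigma>-orbit, so \<sigma> agrees with
  \<open>p\<close> there, and its \<sigma>-cycle would be a nontrivial cycle of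
  \<open>p\<close>.\<close>

lemma permutes_eq_id_if_no_cycles:
  assumes "finite X" "\<sigma> permutes X" "ncycles X p = {}"
    and "\<And>u. u \<in> X \<Longrightarrow> \<sigma> u = u \<or> \<sigma> u = p u"
  shows "\<sigma> = id"
proof (rule ccontr)
  assume "\<sigma> \<noteq> id"
  then obtain u where u: "\<sigma> u \<noteq> u" by (auto simp: fun_eq_iff)
  then have uX: "u \<in> X" using assms(2) by (meson permutes_not_in)
  have *: "\<sigma> ((\<sigma> ^^ n) u) \<noteq> (\<sigma> ^^ n) u" for n
    using u injD[OF permutes_inj[OF assms(2)]] by (induction n) auto
  have nX: "(\<sigma> ^^ n) u \<in> X" for n
    using uX permutes_in_image[OF assms(2)] by (induction n) auto
  have eq: "(\<sigma> ^^ n) u = (p ^^ n) u" for n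
  proof (induction n)
    case (Suc n)
    have "\<sigma> ((\<sigma> ^^ n) u) = p ((\<sigma> ^^ n) u)" using assms(4)[OF nX] * by blast
    then show ?case using Suc by simp
  qed simp
  have "u \<in> orbit \<sigma> u"
    using assms by (intro permutation_self_in_orbit) (auto simp: permutation_permutes)
  then have "u \<in> orbit p u" by (simp add: orbit_altdef eq)
  moreover have "p u \<noteq> u" using eq[of 1] u by simp
  ultimately show False using assms(3) uX by (auto simp: ncycles_def)
qed

text \<open>Induction on the number of nontrivial cycles: cutting one at a point splits off its
  factor, and without such cycles only the identity permutation contributes.\<close>

lemma det_on_fmat:
  fixes \<epsilon> :: "'a::{idom,ring_char_0}"
  assumes "finite X" "p ` X \<subseteq> X" and \<epsilon>: "\<epsilon> = 1 \<or> \<epsilon> = - 1"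
  shows "det_on X (fmat \<epsilon> p) = (if \<exists>C\<in>ncycles X p. (- \<epsilon>) ^ card C = 1 then 0 else 2 ^ card (ncycles X p))"
  using assms(2)
proof (induction "card (ncycles X p)" arbitrary: p)
  case 0
  then have nc: "ncycles X p = {}" using finite_ncycles[OF assms(1)] by simp
  \<comment> \<open>The exceptional point is a dummy: all diagonal entries of \<open>fmat\<close>
    are 1, so both branches give 1.\<close>
  have "det_on X (fmat \<epsilon> p) = (if undefined \<in> X then fmat \<epsilon> p undefined undefined else 1)"
  proof (rule det_on_only_id[OF assms(1)])
    fix \<sigma> assume s: "\<sigma> permutes X" "\<sigma> \<noteq> id"
    then obtain u where "u \<in> X" "\<sigma> u \<noteq> u" "\<sigma> u \<noteq> p u"
      using permutes_eq_id_if_no_cycles[OF assms(1) s(1) nc] by blast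
    then show "\<exists>u\<in>X. fmat \<epsilon> p u (\<sigma> u) = 0" by (auto simp: fmat_def)
  qed (simp add: fmat_def)
  moreover have "fmat \<epsilon> p undefined undefined = 1" by (simp add: fmat_def)
  ultimately show ?case by (simp add: nc)
next
  case (Suc n)
  then have "ncycles X p \<noteq> {}" by auto
  then obtain y where y: "y \<in> X" "y \<in> orbit p y" "p y \<noteq> y" by (auto simp: ncycles_def)
  let ?q = "p(y := y)"
  have yc: "orbit p y \<in> ncycles X p" using y by (auto simp: ncycles_def)
  have cut: "ncycles X ?q = ncycles X p - {orbit p y}" using ncycles_cut[OF y] .
  then have "n = card (ncycles X ?q)"
    using Suc.hyps(2) yc finite_ncycles[OF assms(1)] by simp
  moreover have "?q ` X \<subseteq> X" using Suc.prems y(1) by auto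
  ultimately have IH: "det_on X (fmat \<epsilon> ?q) =
      (if \<exists>C\<in>ncycles X ?q. (- \<epsilon>) ^ card C = 1 then 0 else 2 ^ n)"
    using Suc.hyps(1)[of ?q] by blast
  have "det_on X (fmat \<epsilon> p) = (1 - (- \<epsilon>) ^ card (orbit p y)) * det_on X ((fmat \<epsilon> p)(y := unit_row y))"
    using Suc.prems y by (intro det_on_cycle assms(1)) auto
  also have "(fmat \<epsilon> p)(y := unit_row y) = fmat \<epsilon> ?q"
    by (auto simp: fun_eq_iff fmat_def unit_row_def)
  finally have step: "det_on X (fmat \<epsilon> p) = (1 - (- \<epsilon>) ^ card (orbit p y)) * det_on X (fmat \<epsilon> ?q)" .
  have pm: "(- \<epsilon>) ^ k = 1 \<or> (- \<epsilon>) ^ k = - 1" for k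
    using \<epsilon> by (induction k) auto
  show ?case
  proof (cases "(- \<epsilon>) ^ card (orbit p y) = 1")
    case True
    then show ?thesis using step yc by auto
  next
    case False
    then have "det_on X (fmat \<epsilon> p) = 2 * det_on X (fmat \<epsilon> ?q)" using step pm[of "card (orbit p y)"] by auto
    moreover have "(\<exists>C\<in>ncycles X p. (- \<epsilon>) ^ card C = 1) \<longleftrightarrow> (\<exists>C\<in>ncycles X ?q. (- \<epsilon>) ^ card C = 1)"
      using False by (auto simp: cut)
    ultimately show ?thesis using IH Suc.hyps(2)[symmetric] by simp
  qed
qed

text \<open>If the forward orbit of \<open>l\<close> reaches \<open>m\<close>, row \<open>m\<close>
  becomes e_m, its original value. If it stops at another fixed point, that point and
  \<open>m\<close> have equal rows. If it enters a cycle of length k avoiding \<open>m\<close>, one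
  turn multiplies the determinant by (-\<epsilon>)^k, while resolving the cycle produces the factor
  1 - (-\<epsilon>)^k; whether or not (-\<epsilon>)^k is 1, one of these two facts forces 0.\<close>

lemma det_on_fmat_replace:
  fixes \<epsilon> :: "'a::{idom,ring_char_0}"
  assumes X: "finite X" "p ` X \<subseteq> X" "l \<in> X" "m \<in> X" and root: "p m = m"
  shows "det_on X ((fmat \<epsilon> p)(m := unit_row l)) =
    (if \<exists>k. (p ^^ k) l = m then (- \<epsilon>) ^ (LEAST k. (p ^^ k) l = m) * det_on X (fmat \<epsilon> p) else 0)"
proof (cases "\<exists>k. (p ^^ k) l = m")
  case True
  define k where "k = (LEAST k. (p ^^ k) l = m)"
  have k: "(p ^^ k) l = m" "\<And>i. i < k \<Longrightarrow> (p ^^ i) l \<noteq> m"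
    unfolding k_def using LeastI_ex[OF True] by (auto dest: not_less_Least)
  have "det_on X ((fmat \<epsilon> p)(m := unit_row l)) = (- \<epsilon>) ^ k * det_on X ((fmat \<epsilon> p)(m := unit_row ((p ^^ k) l)))"
  proof (rule det_on_replace_path[OF X(1,4,2,3) k(2)])
    fix i assume i: "i < k"
    \<comment> \<open>A fixed point met before step \<open>k\<close> would trap the orbit short of
      \<open>m\<close>.\<close>
    show "p ((p ^^ i) l) \<noteq> (p ^^ i) l"
    proof
      assume "p ((p ^^ i) l) = (p ^^ i) l"
      then have "(p ^^ n) ((p ^^ i) l) = (p ^^ i) l" for n by (induction n) auto
      then have "(p ^^ (k - i + i)) l = (p ^^ i) l" unfolding funpow_add o_apply by blast
      then have "(p ^^ k) l = (p ^^ i) l" using i by simp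
      then show False using i k by metis
    qed
  qed auto
  moreover have "(fmat \<epsilon> p)(m := unit_row m) = fmat \<epsilon> p"
    by (auto simp: fun_eq_iff fmat_def unit_row_def root)
  ultimately show ?thesis using True k(1) by (simp add: k_def[symmetric])
next
  case False
  let ?g = "\<lambda>x. det_on X ((fmat \<epsilon> p)(m := unit_row x))"
  have inX: "(p ^^ i) l \<in> X" for i using funpow_image_subset[OF X(2,3)] .
  have "?g l = 0"
  proof (cases "\<exists>i. p ((p ^^ i) l) = (p ^^ i) l")
    case True
    define i where "i = (LEAST i. p ((p ^^ i) l) = (p ^^ i) l)"
    have i: "p ((p ^^ i) l) = (p ^^ i) l" "\<And>j. j < i \<Longrightarrow> p ((p ^^ j) l) \<noteq> (p ^^ j) l"
      unfolding i_def using LeastI_ex[OF True] by (auto dest: not_less_Least)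
    have "?g l = (- \<epsilon>) ^ i * ?g ((p ^^ i) l)"
      using False by (intro det_on_replace_path[OF X(1,4,2,3)] i(2)) auto
    also have "?g ((p ^^ i) l) = 0"
      using X inX[of i] False i(1)
      by (intro det_on_equal_rows[of X m "(p ^^ i) l"]) (auto simp: fmat_def unit_row_def)
    finally show ?thesis by (simp only: mult_zero_right)
  next
    case nofix: False
    obtain i where i: "(p ^^ i) l \<in> orbit p ((p ^^ i) l)"
      using eventually_periodic[OF X(1-3)] by blast
    define y where "y = (p ^^ i) l"
    define k where "k = card (orbit p y)"
    have y: "y \<in> X" "y \<in> orbit p y" "p y \<noteq> y" using inX i nofix by (auto simp: y_def)
    have sh: "(p ^^ j) y = (p ^^ (j + i)) l" for j by (simp add: y_def funpow_add)
    have "m \<notin> orbit p y"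
      using False by (auto simp: orbit_altdef sh)
    then have "?g y = (1 - (- \<epsilon>) ^ k) * det_on X (((fmat \<epsilon> p)(m := unit_row y))(y := unit_row y))"
      unfolding k_def using X y by (intro det_on_cycle) auto
    moreover have "?g y = (- \<epsilon>) ^ k * ?g y"
    proof -
      have "(p ^^ k) y = y" unfolding k_def card_orbit[OF y(2)] using funpow_dist1_prop[OF y(2)] .
      moreover have "?g y = (- \<epsilon>) ^ k * ?g ((p ^^ k) y)"
        using False nofix by (intro det_on_replace_path[OF X(1,4,2) y(1)]) (auto simp: sh)
      ultimately show ?thesis by simp
    qed
    ultimately have "?g y = 0" by (cases "(- \<epsilon>) ^ k = 1") auto
    moreover have "?g l = (- \<epsilon>) ^ i * ?g y"
      unfolding y_def using False nofix by (intro det_on_replace_path[OF X(1,4,2,3)]) auto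
    ultimately show ?thesis by simp
  qed
  then show ?thesis unfolding if_not_P[OF False] .
qed

section \<open>Cycles and components of multigraphs\<close>

lemma sym_adj: "sym (adj ends F)"
  by (auto simp: sym_def adj_def insert_commute)

lemma adj_rtrancl_sym: "(x, y) \<in> (adj ends F)\<^sup>* \<Longrightarrow> (y, x) \<in> (adj ends F)\<^sup>*"
  using symD[OF sym_rtrancl[OF sym_adj]] .

lemma adj_mono: "F \<subseteq> F' \<Longrightarrow> adj ends F \<subseteq> adj ends F'"
  by (auto simp: adj_def)

lemma adj_rtrancl_mono: "(x, y) \<in> (adj ends F)\<^sup>* \<Longrightarrow> F \<subseteq> F' \<Longrightarrow> (x, y) \<in> (adj ends F')\<^sup>*"
  using rtrancl_mono[OF adj_mono] by blast

lemma is_cycle_mono: "is_cycle ends F Cy \<Longrightarrow> F \<subseteq> F' \<Longrightarrow> is_cycle ends F' Cy"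
  unfolding is_cycle_def by blast

lemma is_cycle_subset: "is_cycle ends F Cy \<Longrightarrow> Cy \<subseteq> F"
  unfolding is_cycle_def by auto

lemma is_cycle_restrict: "is_cycle ends F Cy \<Longrightarrow> Cy \<subseteq> F' \<Longrightarrow> is_cycle ends F' Cy"
  unfolding is_cycle_def by metis

lemma is_cycle_loop: "ends e = {v} \<Longrightarrow> e \<in> F \<Longrightarrow> is_cycle ends F {e}"
  unfolding is_cycle_def by (intro exI[of _ "[v]"] exI[of _ "[e]"]) auto

lemma cycle_vertices_connected:
  assumes "length vs = length es" "\<And>i. i < length es \<Longrightarrow> ends (es ! i) = {vs ! i, vs ! (Suc i mod length es)}"
    and "x \<in> set vs" "y \<in> set vs"
  shows "(x, y) \<in> (adj ends (set es))\<^sup>*"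
proof -
  have *: "i < length es \<Longrightarrow> (vs ! 0, vs ! i) \<in> (adj ends (set es))\<^sup>*" for i
  proof (induction i)
    case (Suc i)
    then have "(vs ! i, vs ! Suc i) \<in> adj ends (set es)"
      using assms(2)[of i] unfolding adj_def by auto
    then show ?case using Suc by auto
  qed simp
  then have "(vs ! 0, x) \<in> (adj ends (set es))\<^sup>*" "(vs ! 0, y) \<in> (adj ends (set es))\<^sup>*"
    using assms by (auto simp: in_set_conv_nth)
  then show ?thesis by (meson adj_rtrancl_sym rtrancl_trans)
qed

text \<open>Close a shortest path from \<open>u\<close> to \<open>v\<close> with \<open>e\<close>.
  Minimality makes the vertices distinct, and hence the edges; for \<open>u = v\<close> the path is
  empty and the cycle is the loop \<open>e\<close>.\<close>

lemma cycle_through_edge: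
  assumes "(u, v) \<in> (adj ends F)\<^sup>*" "ends e = {u, v}" "e \<notin> F"
  shows "\<exists>Cy. is_cycle ends (insert e F) Cy \<and> e \<in> Cy"
proof -
  define n where "n = (LEAST n. (u, v) \<in> adj ends F ^^ n)"
  have ex: "\<exists>n. (u, v) \<in> adj ends F ^^ n" using assms(1) by (rule rtrancl_imp_relpow)
  have n: "(u, v) \<in> adj ends F ^^ n" unfolding n_def using LeastI_ex[OF ex] .
  have min: "n \<le> k" if "(u, v) \<in> adj ends F ^^ k" for k unfolding n_def using that by (rule Least_le)
  obtain g where g: "g 0 = u" "g n = v" "\<And>i. i < n \<Longrightarrow> (g i, g (Suc i)) \<in> adj ends F"
    using n unfolding relpow_fun_conv by blast
  have seg: "i \<le> j \<Longrightarrow> j \<le> n \<Longrightarrow> (g i, g j) \<in> adj ends F ^^ (j - i)" for i j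
    unfolding relpow_fun_conv by (rule exI[of _ "\<lambda>k. g (i + k)"]) (auto intro!: g)
  have neq: "g i \<noteq> g j" if "i < j" "j \<le> n" for i j
  proof
    assume "g i = g j"
    then have "(u, g i) \<in> adj ends F ^^ i" "(g i, v) \<in> adj ends F ^^ (n - j)"
      using seg[of 0 i] seg[of j n] that g by simp_all
    then have "(u, v) \<in> adj ends F ^^ (i + (n - j))"
      unfolding relpow_add by (rule relcompI)
    then show False using min[of "i + (n - j)"] that by simp
  qed
  have "\<forall>i<n. \<exists>h. h \<in> F \<and> ends h = {g i, g (Suc i)}" using g(3) unfolding adj_def by blast
  then obtain h where h: "\<And>i. i < n \<Longrightarrow> h i \<in> F" "\<And>i. i < n \<Longrightarrow> ends (h i) = {g i, g (Suc i)}" by metis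
  have hneq: "h i \<noteq> h j" if "i < j" "j < n" for i j
  proof
    assume "h i = h j"
    then have "{g i, g (Suc i)} = {g j, g (Suc j)}" using h that by (metis less_trans)
    then have "g i = g j \<or> g i = g (Suc j)" by blast
    then show False using neq[of i j] neq[of i "Suc j"] that by auto
  qed
  \<comment> \<open>There are \<open>n + 1\<close> vertices and, with \<open>e\<close> appended,
    \<open>n + 1\<close> edges; the last edge leads from \<open>g n\<close> back to
    \<open>g 0\<close>, as the index modulo the length demands.\<close>
  define vs es where "vs = map g [0..<Suc n]" and "es = map h [0..<n] @ [e]"
  have len: "length vs = Suc n" "length es = Suc n" by (simp_all add: vs_def es_def)
  have "distinct vs"
    unfolding vs_def distinct_map using neq
    by (auto simp: inj_on_def simp del: upt_Suc) (metis linorder_neqE_nat less_Suc_eq_le)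
  moreover have "distinct es"
    unfolding es_def using h(1) assms(3) hneq
    by (auto simp: distinct_map inj_on_def) (metis linorder_neqE_nat)
  moreover have "set es \<subseteq> insert e F" using h(1) by (auto simp: es_def)
  moreover have "ends (es ! i) = {vs ! i, vs ! (Suc i mod length es)}" if "i < length es" for i
  proof (cases "i = n")
    case True
    then show ?thesis using g assms(2) unfolding len by (simp add: vs_def es_def nth_append insert_commute del: upt_Suc)
  next
    case False
    then have "i < n" using that len by simp
    then show ?thesis using h(2)[of i] unfolding len by (simp add: vs_def es_def nth_append del: upt_Suc)
  qed
  ultimately have "is_cycle ends (insert e F) (set es)"
    unfolding is_cycle_def using len by (intro exI[of _ vs] exI[of _ es]) auto
  then show ?thesis by (auto simp: es_def)
qed

section \<open>Connected components and the edges inside them\<close>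

definition comp_of :: "('e \<Rightarrow> 'v set) \<Rightarrow> 'v set \<Rightarrow> 'e set \<Rightarrow> 'v \<Rightarrow> 'v set" where
  "comp_of ends X H x = {y \<in> X. (x, y) \<in> (adj ends H)\<^sup>*}"

lemma components_eq: "components ends X H = comp_of ends X H ` X"
  by (auto simp: components_def comp_of_def)

lemma comp_of_self: "x \<in> X \<Longrightarrow> x \<in> comp_of ends X H x"
  by (simp add: comp_of_def)

lemma comp_of_eq: "y \<in> comp_of ends X H x \<Longrightarrow> comp_of ends X H y = comp_of ends X H x"
  by (auto simp: comp_of_def intro: rtrancl_trans adj_rtrancl_sym)

lemma component_eq_comp_of:
  assumes "W \<in> components ends X H" "x \<in> W"
  shows "W = comp_of ends X H x" "x \<in> X"
  using assms comp_of_eq[of x ends X H] by (auto simp: components_eq) (auto simp: comp_of_def)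

lemma component_nonempty: "W \<in> components ends X H \<Longrightarrow> W \<noteq> {}"
  using comp_of_self by (fastforce simp: components_eq)

lemma component_closed:
  assumes "W \<in> components ends X H" "x \<in> W" "y \<in> X" "(x, y) \<in> (adj ends H)\<^sup>*"
  shows "y \<in> W"
  using component_eq_comp_of[OF assms(1,2)] assms by (simp add: comp_of_def)

lemma component_connected:
  assumes "W \<in> components ends X H" and XH: "\<And>e. e \<in> H \<Longrightarrow> ends e \<subseteq> X"
  shows "connected_graph ends W (comp_edges ends H W)"
  unfolding connected_graph_def
proof (intro conjI ballI)
  fix x y assume xy: "x \<in> W" "y \<in> W"
  note W = component_eq_comp_of[OF assms(1) xy(1)]
  have "(x, y) \<in> (adj ends H)\<^sup>*" using xy(2) W by (simp add: comp_of_def)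
  then have "y \<in> W \<and> (x, y) \<in> (adj ends (comp_edges ends H W))\<^sup>*"
  proof (induction rule: rtrancl_induct)
    case (step y z)
    obtain e where e: "e \<in> H" "ends e = {y, z}" using step(2) unfolding adj_def by blast
    have "z \<in> W"
    proof (rule component_closed[OF assms(1), of y])
      show "(y, z) \<in> (adj ends H)\<^sup>*" using step(2) by blast
    qed (use step(3) e XH[OF e(1)] in auto)
    then have "e \<in> comp_edges ends H W" using e step by (simp add: comp_edges_def)
    then have "(y, z) \<in> adj ends (comp_edges ends H W)" using e unfolding adj_def by blast
    then show ?case using step \<open>z \<in> W\<close> by auto
  qed (use xy in simp)
  then show "(x, y) \<in> (adj ends (comp_edges ends H W))\<^sup>*" by simp
qed (use component_nonempty[OF assms(1)] in simp)

fun cycle_len_ok :: "jtype \<Rightarrow> nat \<Rightarrow> bool" where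
  "cycle_len_ok JL k = (k = 1)"
| "cycle_len_ok JQ k = odd k"

text \<open>A loop makes two cyclically consecutive vertices equal; as the vertices of a cycle are
  distinct, its length is then 1.\<close>

lemma cycle_with_loop:
  assumes "is_cycle ends F Cy" "e \<in> Cy" "is_loop ends e"
  shows "Cy = {e}"
proof -
  obtain vs es where c: "es \<noteq> []" "length vs = length es" "distinct vs" "set es = Cy"
    "\<And>i. i < length es \<Longrightarrow> ends (es ! i) = {vs ! i, vs ! (Suc i mod length es)}"
    using assms(1) unfolding is_cycle_def by metis
  obtain i where i: "i < length es" "es ! i = e" using assms(2) c by (metis in_set_conv_nth)
  have "card {vs ! i, vs ! (Suc i mod length es)} = 1" using c(5)[OF i(1)] i assms(3) by (simp add: is_loop_def)
  then have "vs ! i = vs ! (Suc i mod length es)" by (auto simp: card_insert_if split: if_splits)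
  then have "i = Suc i mod length es" using c i nth_eq_iff_index_eq[OF c(3)] by simp
  then have "length es = 1" using i(1) by (metis One_nat_def Suc_lessI lessI mod_less mod_self n_not_Suc_n)
  then have "es = [e]" using i by (cases es) auto
  then show ?thesis using c by auto
qed

lemma Jcond_iff:
  "Jcond J ends W F \<longleftrightarrow> connected_graph ends W F \<and> (\<exists>!Cy. is_cycle ends F Cy) \<and>
     (\<forall>Cy. is_cycle ends F Cy \<longrightarrow> cycle_len_ok J (card Cy))"
proof (cases J)
  case JL
  let ?N = "{e \<in> F. \<not> is_loop ends e}"
  have loop_cycle: "is_cycle ends F {e}" if "e \<in> F" "is_loop ends e" for e
    using that is_cycle_loop[of ends e _ F] by (auto simp: is_loop_def card_1_singleton_iff)
  have "tree_one_loop ends W F \<longleftrightarrow> connected_graph ends W F \<and> (\<exists>!Cy. is_cycle ends F Cy) \<and>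
     (\<forall>Cy. is_cycle ends F Cy \<longrightarrow> card Cy = 1)" (is "?L \<longleftrightarrow> ?R")
  proof
    assume ?L
    then obtain e where e: "{e \<in> F. is_loop ends e} = {e}" and tree: "is_tree ends W ?N"
      unfolding tree_one_loop_def by (metis card_1_singletonE)
    have uniq: "Cy = {e}" if c: "is_cycle ends F Cy" for Cy
    proof (cases "\<exists>d\<in>Cy. is_loop ends d")
      case True
      then obtain d where d: "d \<in> Cy" "is_loop ends d" by blast
      moreover have "d \<in> F" using d is_cycle_subset[OF c] by blast
      ultimately show ?thesis using e cycle_with_loop[OF c d] by auto
    next
      case False
      then have "is_cycle ends ?N Cy"
        using is_cycle_subset[OF c] by (intro is_cycle_restrict[OF c]) auto
      then show ?thesis using tree by (auto simp: is_tree_def)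
    qed
    have "is_cycle ends F {e}" using e by (intro loop_cycle) auto
    moreover have "connected_graph ends W F"
      using tree unfolding is_tree_def connected_graph_def by (blast intro: adj_rtrancl_mono)
    ultimately show ?R using uniq by (metis is_singletonI is_singleton_altdef)
  next
    assume R: ?R
    then obtain Cy where c: "is_cycle ends F Cy" "\<And>D. is_cycle ends F D \<Longrightarrow> D = Cy" by blast
    obtain e where e: "Cy = {e}" using R c by (metis card_1_singletonE)
    have "is_loop ends e"
    proof -
      obtain vs es where "length vs = length es" "distinct es" "set es = {e}"
        "\<forall>i < length es. ends (es ! i) = {vs ! i, vs ! (Suc i mod length es)}"
        using c(1) unfolding is_cycle_def e by metis
      moreover from this have "length es = 1" by (metis distinct_card is_singletonI is_singleton_altdef)
      ultimately show ?thesis by (auto simp: is_loop_def length_Suc_conv)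
    qed
    then have loops: "{d \<in> F. is_loop ends d} = {e}"
    proof -
      have "d = e" if "d \<in> F" "is_loop ends d" for d using c(2)[OF loop_cycle[OF that]] e by simp
      moreover have "e \<in> F" using is_cycle_subset[OF c(1)] e by simp
      ultimately show ?thesis using \<open>is_loop ends e\<close> by blast
    qed
    have "\<not> is_cycle ends ?N D" for D
    proof
      assume D: "is_cycle ends ?N D"
      then have "D = {e}" using c(2) e is_cycle_mono by (metis (no_types, lifting) mem_Collect_eq subsetI)
      then show False using is_cycle_subset[OF D] \<open>is_loop ends e\<close> by auto
    qed
    moreover have "(x, y) \<in> (adj ends ?N)\<^sup>*" if xy: "(x, y) \<in> adj ends F" for x y
    proof (cases "x = y")
      case False
      then have "(x, y) \<in> adj ends ?N" using xy by (auto simp: adj_def is_loop_def)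
      then show ?thesis by blast
    qed simp
    then have "adj ends F \<subseteq> (adj ends ?N)\<^sup>*" by auto
    then have "connected_graph ends W ?N"
      using R unfolding connected_graph_def by (metis (no_types, lifting) rtrancl_subset_rtrancl subsetD)
    ultimately show ?L unfolding tree_one_loop_def loops is_tree_def by simp
  qed
  then show ?thesis by (simp add: JL Jcond_def)
qed (simp add: Jcond_def odd_unicyclic_def)

section \<open>Orientations in which every non-root vertex owns an edge\<close>

lemma orbit_self_if_image_eq:
  assumes "finite V" "p ` V = V" "x \<in> V"
  shows "x \<in> orbit p x"
proof -
  let ?q = "\<lambda>v. if v \<in> V then p v else v"
  have "bij_betw p V V" using assms by (simp add: bij_betw_def finite_surj_inj)
  then have "?q permutes V" by (intro bij_imp_permutes) (auto cong: bij_betw_cong)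
  then have "x \<in> orbit ?q x"
    using assms(1) by (intro permutation_self_in_orbit) (auto simp: permutation_permutes)
  also have "orbit ?q x = orbit p x"
    using assms by (intro orbit_cong0[of x V]) auto
  finally show ?thesis .
qed

text \<open>Each non-root \<open>u\<close> owns the edge \<open>f u\<close> and points along it to
  \<open>p u\<close>; \<open>bij\<close> gives every edge of \<open>H\<close> exactly one owner. An
  owned self-loop means \<open>p u = u\<close>, so the fixed points in \<open>X\<close> are the
  roots and the owners of loops.\<close>

locale orientation =
  fixes ends :: "'e \<Rightarrow> 'v set" and X R :: "'v set" and f :: "'v \<Rightarrow> 'e" and p :: "'v \<Rightarrow> 'v" and H :: "'e set"
  assumes finX: "finite X" and RX: "R \<subseteq> X"
    and ends_f: "u \<in> X - R \<Longrightarrow> ends (f u) = {u, p u}"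
    and p_in: "u \<in> X - R \<Longrightarrow> p u \<in> X"
    and p_out: "u \<notin> X - R \<Longrightarrow> p u = u"
    and bij: "bij_betw f (X - R) H"
begin

lemma p_image: "p ` X \<subseteq> X"
  using p_in p_out by (metis image_subsetI)

lemma f_inj: "u \<in> X - R \<Longrightarrow> v \<in> X - R \<Longrightarrow> f u = f v \<Longrightarrow> u = v"
  using bij by (auto simp: bij_betw_def inj_on_def)

lemma f_in: "u \<in> X - R \<Longrightarrow> f u \<in> H"
  using bij by (auto simp: bij_betw_def)

lemma edgeE:
  assumes "e \<in> H" obtains u where "u \<in> X - R" "e = f u" "ends e = {u, p u}"
  using assms bij ends_f by (auto simp: bij_betw_def)

lemma ends_subset: "e \<in> H \<Longrightarrow> ends e \<subseteq> X"
  using p_in by (auto elim!: edgeE)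

lemma p_adj: "(x, p x) \<in> (adj ends H)\<^sup>*"
proof (cases "x \<in> X - R")
  case True
  then have "(x, p x) \<in> adj ends H" using ends_f f_in unfolding adj_def by blast
  then show ?thesis by blast
qed (simp add: p_out)

lemma funpow_adj: "(x, (p ^^ n) x) \<in> (adj ends H)\<^sup>*"
proof (induction n)
  case (Suc n)
  then show ?case using p_adj[of "(p ^^ n) x"] by simp
qed simp

text \<open>Every edge of \<open>H\<close> joins some u with \<open>p u\<close>, so a step along it
  in either direction keeps forward orbits meeting. This is why a component of \<open>H\<close> has
  a single periodic orbit.\<close>

lemma adj_coalesce:
  assumes "(x, y) \<in> (adj ends H)\<^sup>*"
  shows "\<exists>i j. (p ^^ i) x = (p ^^ j) y"
  using assms
proof (induction rule: rtrancl_induct)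
  case base
  show ?case by (intro exI[of _ 0]) simp
next
  case (step y z)
  obtain e where e: "e \<in> H" "ends e = {y, z}" using step(2) unfolding adj_def by blast
  obtain u where "ends e = {u, p u}" using edgeE[OF e(1)] by blast
  then have "z = p y \<or> y = p z" using e(2) by (auto simp: doubleton_eq_iff)
  obtain i j where ij: "(p ^^ i) x = (p ^^ j) y" using step by blast
  show ?case using \<open>z = p y \<or> y = p z\<close>
  proof
    assume "z = p y"
    then have "(p ^^ Suc i) x = (p ^^ j) z" using ij by (simp add: funpow_swap1)
    then show ?thesis by blast
  next
    assume "y = p z"
    then have "(p ^^ i) x = (p ^^ Suc j) z" using ij by (simp add: funpow_swap1)
    then show ?thesis by blast
  qed
qed

lemma connected_iff: "(x, y) \<in> (adj ends H)\<^sup>* \<longleftrightarrow> (\<exists>i j. (p ^^ i) x = (p ^^ j) y)"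
  by (metis adj_coalesce funpow_adj adj_rtrancl_sym rtrancl_trans)

lemma periodic_connected:
  assumes "x \<in> orbit p x" "y \<in> orbit p y" "(x, y) \<in> (adj ends H)\<^sup>*"
  shows "orbit p x = orbit p y"
proof -
  obtain i j where "(p ^^ i) x = (p ^^ j) y" using adj_coalesce[OF assms(3)] by blast
  then show ?thesis
    using funpow_in_orbit[OF assms(1), of i] funpow_in_orbit[OF assms(2), of j] orbit_eq_if_mem assms(1,2)
    by metis
qed

lemma orbit_root: "r \<in> R \<Longrightarrow> orbit p r = {r}"
  using p_out by (simp add: orbit_eq_singleton_iff)

lemma funpow_root: "r \<in> R \<Longrightarrow> (p ^^ n) r = r"
  using p_out by (induction n) auto

lemma orbit_nonroot:
  assumes "x \<in> X - R" "x \<in> orbit p x"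
  shows "orbit p x \<subseteq> X - R"
proof
  fix z assume z: "z \<in> orbit p x"
  moreover have "z \<in> X" using z orbit_image_subset[OF p_image] assms by blast
  moreover have "z \<notin> R"
    using orbit_root[of z] orbit_eq_if_mem[OF assms(2) z] assms by auto
  ultimately show "z \<in> X - R" by blast
qed

text \<open>Each point of a periodic orbit owns the edge to the next point, and injectivity of
  \<open>f\<close> keeps these edges distinct. A fixed point yields its self-loop, a cycle of length
  1.\<close>

lemma cycle_of_orbit:
  assumes "x \<in> X - R" "x \<in> orbit p x"
  shows "is_cycle ends (f ` orbit p x) (f ` orbit p x)" "card (f ` orbit p x) = card (orbit p x)"
proof -
  note sub = orbit_nonroot[OF assms]
  have inj: "inj_on f (orbit p x)"
    using sub bij inj_on_subset by (auto simp: bij_betw_def)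
  then show "card (f ` orbit p x) = card (orbit p x)" by (rule card_image)
  define k where "k = funpow_dist1 p x x"
  have k: "k > 0" "(p ^^ k) x = x" "orbit p x = (\<lambda>n. (p ^^ n) x) ` {0..<k}" "inj_on (\<lambda>n. (p ^^ n) x) {0..<k}"
    unfolding k_def using funpow_dist1_prop[OF assms(2)] orbit_conv_funpow_dist1[OF assms(2)]
      inj_on_funpow_dist1[OF assms(2)] by blast+
  define vs es where "vs = map (\<lambda>n. (p ^^ n) x) [0..<k]" and "es = map f vs"
  have sv: "set vs = orbit p x" by (simp add: vs_def k(3))
  have "distinct vs" using k(4) by (simp add: vs_def distinct_map)
  moreover have "distinct es" using inj sv \<open>distinct vs\<close> by (simp add: es_def distinct_map)
  moreover have "ends (es ! i) = {vs ! i, vs ! (Suc i mod length es)}" if "i < length es" for i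
  proof -
    have i: "i < k" "length es = k" using that by (simp_all add: es_def vs_def)
    have "vs ! i \<in> X - R" using sub sv i by (metis es_def length_map nth_mem subsetD)
    then have "ends (es ! i) = {vs ! i, p (vs ! i)}" using i by (simp add: es_def vs_def ends_f)
    moreover have "p (vs ! i) = vs ! (Suc i mod k)"
    proof (cases "Suc i = k")
      case True
      then have "p ((p ^^ i) x) = x" using k(2) by auto
      then show ?thesis using i True k(1) by (simp add: vs_def)
    qed (use i in \<open>simp add: vs_def\<close>)
    ultimately show ?thesis using i by simp
  qed
  moreover have "es \<noteq> []" "length vs = length es" using k(1) by (simp_all add: es_def vs_def)
  moreover have "set es = f ` orbit p x" by (simp add: es_def sv)
  ultimately show "is_cycle ends (f ` orbit p x) (f ` orbit p x)"
    unfolding is_cycle_def by (intro exI[of _ vs] exI[of _ es]) auto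
qed

text \<open>The k edges of a cycle are the images under the injection f of k of its k vertices, hence of all
  of them, so the vertex set is invariant under p.\<close>

lemma orbit_of_cycle:
  assumes "is_cycle ends F Cy" "F \<subseteq> H"
  obtains x where "x \<in> X - R" "x \<in> orbit p x" "Cy = f ` orbit p x" "x \<in> \<Union> (ends ` Cy)"
proof -
  obtain vs es where c: "es \<noteq> []" "length vs = length es" "distinct vs" "distinct es"
      "set es \<subseteq> F" "set es = Cy"
      "\<And>i. i < length es \<Longrightarrow> ends (es ! i) = {vs ! i, vs ! (Suc i mod length es)}"
    using assms(1) unfolding is_cycle_def by metis
  define k where "k = length es"
  have kp: "k > 0" using c(1) by (simp add: k_def)
  have ends_sub: "ends e \<subseteq> set vs" if e: "e \<in> set es" for e
  proof -
    obtain i where "i < k" "e = es ! i" using e by (metis in_set_conv_nth k_def)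
    moreover have "Suc i mod k < k" using kp by simp
    ultimately show ?thesis using c(2) c(7)[of i] by (simp add: k_def)
  qed
  define g where "g = inv_into (X - R) f"
  have g: "g e \<in> X - R" "f (g e) = e" "g e \<in> ends e" if "e \<in> set es" for e
  proof -
    have "e \<in> f ` (X - R)" using that c(5) assms(2) bij by (auto simp: bij_betw_def)
    then show "g e \<in> X - R" "f (g e) = e" unfolding g_def by (rule inv_into_into, rule f_inv_into_f)
    then show "g e \<in> ends e" using ends_f[of "g e"] by auto
  qed
  have "inj_on g (set es)" by (metis g(2) inj_onI)
  then have "card (g ` set es) = card (set vs)"
    using c(2) distinct_card[OF c(3)] distinct_card[OF c(4)] by (simp add: card_image)
  moreover have "g ` set es \<subseteq> set vs" using g(3) ends_sub by blast
  ultimately have gimg: "g ` set es = set vs" by (intro card_subset_eq) auto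
  have vsX: "set vs \<subseteq> X - R" unfolding gimg[symmetric] using g(1) by blast
  have f_vs: "f ` set vs = set es" unfolding gimg[symmetric] using g(2) by force
  have p_vs: "p v \<in> set vs" if "v \<in> set vs" for v
    using ends_f[of v] vsX that f_vs ends_sub[of "f v"] by blast
  \<comment> \<open>On a cycle of length above 1 each vertex v lies on two cycle edges. One of them
    is not \<open>f v\<close>, so it is owned by another cycle vertex u, with
    \<open>p u = v\<close>.\<close>
  have "set vs \<subseteq> p ` set vs"
  proof
    fix v assume v: "v \<in> set vs"
    then obtain i where i: "i < k" "v = vs ! i" by (metis in_set_conv_nth c(2) k_def)
    \<comment> \<open>The cyclic predecessor of \<open>i\<close>; the two coincide only for a
      loop.\<close>
    define j where "j = (if i = 0 then k - 1 else i - 1)"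
    have j: "j < k" "Suc j mod k = i" using i kp by (auto simp: j_def)
    show "v \<in> p ` set vs"
    proof (cases "i = j")
      case True
      then have "k = 1" using i kp by (auto simp: j_def split: if_splits)
      then have "set vs = {v}" using i c(2) by (auto simp: k_def length_Suc_conv)
      then show ?thesis using p_vs[OF v] by auto
    next
      case False
      then have "es ! i \<noteq> es ! j" using i j c(4) by (simp add: nth_eq_iff_index_eq k_def)
      moreover have "v \<in> ends (es ! i)" "v \<in> ends (es ! j)"
        using c(7)[of i] c(7)[of j] i j by (simp_all add: k_def)
      ultimately obtain e where e: "e \<in> set es" "e \<noteq> f v" "v \<in> ends e"
        using i j by (metis nth_mem k_def)
      obtain u where u: "u \<in> set vs" "e = f u" using e(1) f_vs by blast
      then have "p u = v" using e ends_f[of u] vsX by auto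
      then show ?thesis using u by blast
    qed
  qed
  then have pV: "p ` set vs = set vs" using p_vs by blast
  have per: "v \<in> orbit p v" if "v \<in> set vs" for v
    using that pV by (intro orbit_self_if_image_eq[of "set vs"]) auto
  define x where "x = vs ! 0"
  have x: "x \<in> set vs" using c(1,2) by (simp add: x_def)
  have "set vs = orbit p x"
  proof
    show "set vs \<subseteq> orbit p x"
    proof
      fix v assume v: "v \<in> set vs"
      have "(x, v) \<in> (adj ends (set es))\<^sup>*" by (rule cycle_vertices_connected[OF c(2) c(7) x v])
      then have "(x, v) \<in> (adj ends H)\<^sup>*" by (rule adj_rtrancl_mono) (use c(5) assms(2) in blast)
      then show "v \<in> orbit p x" using periodic_connected[OF per[OF x] per[OF v]] per[OF v] by simp
    qed
    show "orbit p x \<subseteq> set vs" using pV x by (intro orbit_image_subset) auto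
  qed
  then have "Cy = f ` orbit p x" using f_vs c(6) by simp
  moreover have "x \<in> \<Union> (ends ` Cy)" using x f_vs c(6) ends_f[of x] vsX by auto
  ultimately show thesis using that[of x] x vsX per by blast
qed

lemma comp_edges_cycle:
  assumes W: "W \<in> components ends X H" and c: "is_cycle ends (comp_edges ends H W) Cy"
  obtains x where "x \<in> W" "x \<in> X - R" "x \<in> orbit p x" "Cy = f ` orbit p x" "card Cy = card (orbit p x)"
proof -
  obtain x where x: "x \<in> X - R" "x \<in> orbit p x" "Cy = f ` orbit p x" "x \<in> \<Union> (ends ` Cy)"
    using orbit_of_cycle[OF c] by (auto simp: comp_edges_def)
  moreover have "x \<in> W" using x(4) is_cycle_subset[OF c] by (auto simp: comp_edges_def)
  ultimately show thesis using that cycle_of_orbit(2) by metis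
qed

lemma orbit_cycle_in_component:
  assumes W: "W \<in> components ends X H" and x: "x \<in> W" "x \<in> X - R" "x \<in> orbit p x"
  shows "is_cycle ends (comp_edges ends H W) (f ` orbit p x)" "orbit p x \<subseteq> W"
proof -
  show oW: "orbit p x \<subseteq> W"
  proof
    fix z assume z: "z \<in> orbit p x"
    then have "(x, z) \<in> (adj ends H)\<^sup>*" using funpow_adj by (auto simp: orbit_altdef)
    then show "z \<in> W" using orbit_nonroot[OF x(2,3)] z by (intro component_closed[OF W x(1)]) auto
  qed
  have "f ` orbit p x \<subseteq> comp_edges ends H W"
  proof
    fix e assume "e \<in> f ` orbit p x"
    then obtain z where z: "z \<in> orbit p x" "e = f z" by blast
    then have "z \<in> X - R" "p z \<in> orbit p x" using orbit_nonroot[OF x(2,3)] by (auto intro: orbit.step)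
    then show "e \<in> comp_edges ends H W" using z oW f_in ends_f by (auto simp: comp_edges_def)
  qed
  then show "is_cycle ends (comp_edges ends H W) (f ` orbit p x)"
    using is_cycle_mono[OF cycle_of_orbit(1)[OF x(2,3)]] by blast
qed

lemma component_periodic:
  assumes W: "W \<in> components ends X H"
  obtains x where "x \<in> W" "x \<in> orbit p x"
proof -
  obtain y where y: "y \<in> W" using component_nonempty[OF W] by blast
  then have "y \<in> X" using component_eq_comp_of[OF W] by blast
  then obtain i where i: "(p ^^ i) y \<in> orbit p ((p ^^ i) y)"
    using eventually_periodic[OF finX p_image] by blast
  moreover have "(p ^^ i) y \<in> W"
    using funpow_adj funpow_image_subset[OF p_image \<open>y \<in> X\<close>] by (intro component_closed[OF W y])
  ultimately show thesis using that by blast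
qed

lemma component_periodic_unique:
  assumes W: "W \<in> components ends X H" "x \<in> W" "y \<in> W" "x \<in> orbit p x" "y \<in> orbit p y"
  shows "orbit p x = orbit p y"
proof -
  have "(x, y) \<in> (adj ends H)\<^sup>*"
    using component_eq_comp_of(1)[OF W(1,2)] W(3) by (auto simp: comp_of_def)
  then show ?thesis using periodic_connected W by blast
qed

text \<open>A root is itself a periodic orbit, and a component has only one; this leaves room for
  neither a second root nor a cycle.\<close>

lemma root_component:
  assumes W: "W \<in> components ends X H" and r: "r \<in> W" "r \<in> R"
  shows "W \<inter> R = {r}" "is_tree ends W (comp_edges ends H W)"
proof -
  have orb: "orbit p s = {r}" if "s \<in> W" "s \<in> orbit p s" for s
    using component_periodic_unique[OF W that(1) r(1) that(2)] orbit_root[OF r(2)] by auto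
  show "W \<inter> R = {r}" using orb orbit_root r by fastforce
  have "\<not> is_cycle ends (comp_edges ends H W) Cy" for Cy
  proof
    assume "is_cycle ends (comp_edges ends H W) Cy"
    then obtain x where "x \<in> W" "x \<in> X - R" "x \<in> orbit p x" using comp_edges_cycle[OF W] by blast
    then show False using orb[of x] r by auto
  qed
  then show "is_tree ends W (comp_edges ends H W)"
    using component_connected[OF W ends_subset] by (simp add: is_tree_def)
qed

lemma Jcond_component:
  assumes W: "W \<in> components ends X H" and x: "x \<in> W" "x \<in> X - R" "x \<in> orbit p x"
  shows "Jcond J ends W (comp_edges ends H W) \<longleftrightarrow> cycle_len_ok J (card (orbit p x))"
proof -
  have uniq: "Cy = f ` orbit p x" if "is_cycle ends (comp_edges ends H W) Cy" for Cy
    using comp_edges_cycle[OF W that] component_periodic_unique[OF W _ x(1) _ x(3)] by metis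
  then have "is_cycle ends (comp_edges ends H W) Cy \<longleftrightarrow> Cy = f ` orbit p x" for Cy
    using orbit_cycle_in_component(1)[OF W x] by blast
  then show ?thesis
    using component_connected[OF W ends_subset] cycle_of_orbit(2)[OF x(2,3)] by (simp add: Jcond_iff)
qed

end

text \<open>One family for both sides of the quotient: the denominator takes the boundary as
  \<open>R\<close>; the numerator adds \<open>m\<close> to \<open>R\<close> and then demands
  \<open>l\<close> in the component of \<open>m\<close>.\<close>

definition rooted_family :: "jtype \<Rightarrow> ('e \<Rightarrow> 'v set) \<Rightarrow> 'v set \<Rightarrow> 'v set \<Rightarrow> 'e set \<Rightarrow> 'e set set" where
  "rooted_family J ends X R E = {H. H \<subseteq> E \<and>
     (\<forall>W \<in> components ends X H.
        (W \<inter> R \<noteq> {} \<longrightarrow> card (W \<inter> R) = 1 \<and> is_tree ends W (comp_edges ends H W))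
      \<and> (W \<inter> R = {} \<longrightarrow> Jcond J ends W (comp_edges ends H W)))}"

context orientation
begin

text \<open>The single periodic orbit of a component is its root or its cycle, so membership depends
  on orbit lengths of \<open>p\<close> alone, in the form in which the determinant sees
  them.\<close>

lemma rooted_family_iff:
  assumes "H \<subseteq> E"
  shows "H \<in> rooted_family J ends X R E \<longleftrightarrow>
    (\<forall>x\<in>X - R. x \<in> orbit p x \<longrightarrow> cycle_len_ok J (card (orbit p x)))" (is "_ \<longleftrightarrow> ?ok")
proof
  assume fam: "H \<in> rooted_family J ends X R E"
  show ?ok
  proof (intro ballI impI)
    fix x assume x: "x \<in> X - R" "x \<in> orbit p x"
    define W where "W = comp_of ends X H x"
    have W: "W \<in> components ends X H" "x \<in> W" using x comp_of_self by (auto simp: W_def components_eq)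
    have "W \<inter> R = {}"
    proof (rule ccontr)
      assume "W \<inter> R \<noteq> {}"
      then obtain r where "r \<in> W" "r \<in> R" by blast
      then show False
        using component_periodic_unique[OF W, of r] orbit_root[of r] x by auto
    qed
    then show "cycle_len_ok J (card (orbit p x))"
      using fam W(1) Jcond_component[OF W x, of J] unfolding rooted_family_def by blast
  qed
next
  assume ok: ?ok
  show "H \<in> rooted_family J ends X R E"
    unfolding rooted_family_def
  proof (intro CollectI conjI assms ballI impI)
    fix W assume W: "W \<in> components ends X H"
    show "card (W \<inter> R) = 1" "is_tree ends W (comp_edges ends H W)" if "W \<inter> R \<noteq> {}"
      using that root_component[OF W] by fastforce+
    show "Jcond J ends W (comp_edges ends H W)" if WR: "W \<inter> R = {}"
    proof -
      obtain x where x: "x \<in> W" "x \<in> orbit p x" using component_periodic[OF W] by blast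
      moreover have "x \<in> X - R" using x WR component_eq_comp_of(2)[OF W] by blast
      ultimately show ?thesis using ok Jcond_component[OF W] by blast
    qed
  qed
qed

end

section \<open>Existence of orientations\<close>

text \<open>Vertices outside the core C choose the first edge of a shortest path to C. This choice is
  injective, and an edge that is not chosen would close a cycle not contained in K.\<close>

lemma orientation_from_core:
  assumes conn: "connected_graph ends W F" and ends2: "\<And>e. e \<in> F \<Longrightarrow> \<exists>x\<in>W. \<exists>y\<in>W. ends e = {x, y}"
    and K: "K \<subseteq> F" "\<And>e. e \<in> K \<Longrightarrow> ends e \<subseteq> C"
    and C: "C \<subseteq> W" "C \<noteq> {}" "\<And>x y. x \<in> C \<Longrightarrow> y \<in> C \<Longrightarrow> (x, y) \<in> (adj ends K)\<^sup>*"
    and g: "bij_betw g B K" "B \<subseteq> C" "\<And>u. u \<in> B \<Longrightarrow> u \<in> ends (g u)"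
    and cyc: "\<And>Cy. is_cycle ends F Cy \<Longrightarrow> Cy \<subseteq> K"
  shows "\<exists>f. bij_betw f (B \<union> (W - C)) F \<and> (\<forall>u\<in>B \<union> (W - C). u \<in> ends (f u))"
proof -
  define d where "d x = (LEAST n. \<exists>c\<in>C. (c, x) \<in> adj ends F ^^ n)" for x
  have d_le: "d x \<le> n" if "c \<in> C" "(c, x) \<in> adj ends F ^^ n" for c x n
    unfolding d_def using that by (intro Least_le) blast
  have "\<exists>e y. e \<in> F \<and> ends e = {x, y} \<and> d y < d x" if x: "x \<in> W - C" for x
  proof -
    obtain c0 where "c0 \<in> C" using C(2) by blast
    then have "(c0, x) \<in> (adj ends F)\<^sup>*" using conn x C(1) by (auto simp: connected_graph_def)
    then have "\<exists>n. \<exists>c\<in>C. (c, x) \<in> adj ends F ^^ n" using \<open>c0 \<in> C\<close> rtrancl_imp_relpow by blast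
    then have "\<exists>c\<in>C. (c, x) \<in> adj ends F ^^ d x" unfolding d_def by (rule LeastI_ex)
    then obtain c where c: "c \<in> C" "(c, x) \<in> adj ends F ^^ d x" by blast
    obtain n where n: "d x = Suc n" using c x by (cases "d x") auto
    then obtain y where y: "(c, y) \<in> adj ends F ^^ n" "(y, x) \<in> adj ends F" using c(2) by auto
    obtain e where "e \<in> F" "ends e = {x, y}" using y(2) unfolding adj_def by (auto simp: insert_commute)
    moreover have "d y < d x" using d_le[OF c(1) y(1)] n by simp
    ultimately show ?thesis by blast
  qed
  then obtain h nx where h: "\<And>x. x \<in> W - C \<Longrightarrow> h x \<in> F" "\<And>x. x \<in> W - C \<Longrightarrow> ends (h x) = {x, nx x}"
    "\<And>x. x \<in> W - C \<Longrightarrow> d (nx x) < d x" by metis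
  have nxW: "nx x \<in> W" if x: "x \<in> W - C" for x
  proof -
    obtain a b where "a \<in> W" "b \<in> W" "ends (h x) = {a, b}" using ends2[OF h(1)[OF x]] by blast
    moreover have "nx x \<in> ends (h x)" using h(2)[OF x] by simp
    ultimately show ?thesis by auto
  qed
  define I where "I = K \<union> h ` (W - C)"
  have IF: "I \<subseteq> F" using K(1) h(1) by (auto simp: I_def)
  have toC: "x \<in> W \<Longrightarrow> \<exists>c\<in>C. (x, c) \<in> (adj ends I)\<^sup>*" for x
  proof (induction "d x" arbitrary: x rule: less_induct)
    case less
    show ?case
    proof (cases "x \<in> C")
      case False
      then have x: "x \<in> W - C" using less.prems by blast
      obtain c where "c \<in> C" "(nx x, c) \<in> (adj ends I)\<^sup>*" using less.hyps[OF h(3)[OF x] nxW[OF x]] by blast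
      moreover have "(x, nx x) \<in> adj ends I" using h(2)[OF x] x unfolding adj_def I_def by blast
      ultimately show ?thesis by (meson converse_rtrancl_into_rtrancl)
    qed blast
  qed
  have connI: "(x, y) \<in> (adj ends I)\<^sup>*" if xy: "x \<in> W" "y \<in> W" for x y
  proof -
    obtain c c' where "c \<in> C" "(x, c) \<in> (adj ends I)\<^sup>*" "c' \<in> C" "(y, c') \<in> (adj ends I)\<^sup>*"
      using toC[OF xy(1)] toC[OF xy(2)] by blast
    moreover from this have "(c, c') \<in> (adj ends I)\<^sup>*"
      using adj_rtrancl_mono[OF C(3)] by (auto simp: I_def)
    ultimately show ?thesis by (meson adj_rtrancl_sym rtrancl_trans)
  qed
  have "F \<subseteq> I"
  proof (rule ccontr)
    assume "\<not> F \<subseteq> I"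
    then obtain e where e: "e \<in> F" "e \<notin> I" by blast
    obtain x y where xy: "x \<in> W" "y \<in> W" "ends e = {x, y}" using ends2[OF e(1)] by blast
    obtain Cy where "is_cycle ends (insert e I) Cy" "e \<in> Cy"
      using cycle_through_edge[OF connI[OF xy(1,2)] xy(3) e(2)] by blast
    then have "e \<in> K" using cyc is_cycle_mono[of ends "insert e I" Cy F] e IF by blast
    then show False using e by (simp add: I_def)
  qed
  then have I: "I = F" using IF by blast
  \<comment> \<open>If two different vertices chose the same edge, each would be the
    \<open>nx\<close> of the other, and \<open>d\<close> would drop in both directions.\<close>
  have "inj_on h (W - C)"
  proof (rule inj_onI)
    fix x x' assume x: "x \<in> W - C" "x' \<in> W - C" "h x = h x'"
    then have "{x, nx x} = {x', nx x'}" using h(2) by metis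
    then show "x = x'" using h(3)[OF x(1)] h(3)[OF x(2)] by (auto simp: doubleton_eq_iff)
  qed
  then have "bij_betw h (W - C) (h ` (W - C))" by (simp add: bij_betw_def)
  moreover have "K \<inter> h ` (W - C) = {}" using K(2) h(2) by blast
  ultimately have "bij_betw (\<lambda>u. if u \<in> B then g u else h u) (B \<union> (W - C)) (K \<union> h ` (W - C))"
    using g(2) by (intro bij_betw_disjoint_Un g(1)) auto
  then show ?thesis
    using g(2,3) h(2) unfolding I_def[symmetric] I
    by (intro exI[of _ "\<lambda>u. if u \<in> B then g u else h u"]) auto
qed

text \<open>The core is the root alone, without edges. It owns nothing, so \<open>B\<close> is empty
  and the map on it is arbitrary.\<close>

lemma tree_orientation:
  assumes "is_tree ends W F" "r \<in> W" "\<And>e. e \<in> F \<Longrightarrow> \<exists>x\<in>W. \<exists>y\<in>W. ends e = {x, y}"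
  shows "\<exists>f. bij_betw f (W - {r}) F \<and> (\<forall>u\<in>W - {r}. u \<in> ends (f u))"
  using orientation_from_core[of ends W F "{}" "{r}" undefined "{}"] assms by (simp add: is_tree_def bij_betw_def)

text \<open>The core is the unique cycle, on which the i-th vertex owns the i-th edge.\<close>

lemma unicyclic_orientation:
  assumes "connected_graph ends W F" "\<exists>!Cy. is_cycle ends F Cy"
    and ends2: "\<And>e. e \<in> F \<Longrightarrow> \<exists>x\<in>W. \<exists>y\<in>W. ends e = {x, y}"
  shows "\<exists>f. bij_betw f W F \<and> (\<forall>u\<in>W. u \<in> ends (f u))"
proof -
  obtain Cy where Cy: "is_cycle ends F Cy" "\<And>D. is_cycle ends F D \<Longrightarrow> D = Cy" using assms(2) by blast
  obtain vs es where c: "es \<noteq> []" "length vs = length es" "distinct vs" "distinct es"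
      "set es \<subseteq> F" "set es = Cy"
      "\<And>i. i < length es \<Longrightarrow> ends (es ! i) = {vs ! i, vs ! (Suc i mod length es)}"
    using Cy(1) unfolding is_cycle_def by metis
  have ends_sub: "ends e \<subseteq> set vs" if e: "e \<in> set es" for e
  proof -
    obtain i where "i < length es" "e = es ! i" using e by (metis in_set_conv_nth)
    moreover have "Suc i mod length es < length es" using c(1) by simp
    ultimately show ?thesis using c(2) c(7)[of i] by simp
  qed
  have vsW: "set vs \<subseteq> W"
  proof
    fix v assume "v \<in> set vs"
    then obtain i where "i < length es" "v = vs ! i" by (metis in_set_conv_nth c(2))
    then have "v \<in> ends (es ! i)" "es ! i \<in> F" using c(5,7) by auto
    then show "v \<in> W" using ends2 by fastforce
  qed
  have bv: "bij_betw ((!) vs) {..<length es} (set vs)" using c(2,3) by (intro bij_betw_nth) auto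
  have be: "bij_betw ((!) es) {..<length es} (set es)" using c(4) by (intro bij_betw_nth) auto
  define g where "g = (!) es \<circ> inv_into {..<length es} ((!) vs)"
  have g: "bij_betw g (set vs) (set es)"
    unfolding g_def using bij_betw_inv_into[OF bv] be by (rule bij_betw_trans)
  have "u \<in> ends (g u)" if "u \<in> set vs" for u
  proof -
    define i where "i = inv_into {..<length es} ((!) vs) u"
    have "u \<in> (!) vs ` {..<length es}" using bv that by (simp add: bij_betw_def)
    then have "i \<in> {..<length es}" "vs ! i = u" unfolding i_def by (rule inv_into_into, rule f_inv_into_f)
    then show ?thesis using c(7)[of i] by (simp add: g_def i_def)
  qed
  then have "\<exists>f. bij_betw f (set vs \<union> (W - set vs)) F \<and> (\<forall>u\<in>set vs \<union> (W - set vs). u \<in> ends (f u))"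
    using cycle_vertices_connected[of vs es ends] c vsW ends_sub g Cy(2) ends2
    by (intro orientation_from_core[where K = "set es" and g = g] assms(1)) auto
  moreover have "set vs \<union> (W - set vs) = W" using vsW by blast
  ultimately show ?thesis by simp
qed

text \<open>Orientations of the single components fit together because components are disjoint and
  every edge lies inside one. Thus each member of the family arises from some choice.\<close>

lemma rooted_family_orientation:
  assumes H: "H \<in> rooted_family J ends X R E" and ends2: "\<And>e. e \<in> E \<Longrightarrow> \<exists>x\<in>X. \<exists>y\<in>X. ends e = {x, y}"
  shows "\<exists>f. bij_betw f (X - R) H \<and> (\<forall>u\<in>X - R. u \<in> ends (f u))"
proof -
  let ?CC = "components ends X H"
  have HE: "H \<subseteq> E" using H by (simp add: rooted_family_def)
  have same: "y \<in> W" if e: "e \<in> H" "ends e = {x, y}" and W: "x \<in> W" "W \<in> ?CC" for e x y W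
  proof (rule component_closed[OF W(2,1)])
    obtain a b where "a \<in> X" "b \<in> X" "ends e = {a, b}" using ends2[of e] e(1) HE by blast
    moreover have "y \<in> ends e" using e(2) by simp
    ultimately show "y \<in> X" by auto
    show "(x, y) \<in> (adj ends H)\<^sup>*" using e unfolding adj_def by blast
  qed
  have ce2: "\<exists>x\<in>W. \<exists>y\<in>W. ends e = {x, y}" if "W \<in> ?CC" "e \<in> comp_edges ends H W" for W e
    using ends2[of e] that HE by (fastforce simp: comp_edges_def)
  have "\<exists>f. bij_betw f (W - R) (comp_edges ends H W) \<and> (\<forall>u\<in>W - R. u \<in> ends (f u))" if W: "W \<in> ?CC" for W
  proof (cases "W \<inter> R = {}")
    case True
    then have "Jcond J ends W (comp_edges ends H W)" using H W by (simp add: rooted_family_def)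
    then show ?thesis
      using unicyclic_orientation[of ends W "comp_edges ends H W"] ce2[OF W] True
      by (simp add: Jcond_iff Diff_triv)
  next
    case False
    then have "card (W \<inter> R) = 1" and tree: "is_tree ends W (comp_edges ends H W)"
      using H W by (auto simp: rooted_family_def)
    then obtain r where r: "W \<inter> R = {r}" by (metis card_1_singletonE)
    then have "W - R = W - {r}" "r \<in> W" by blast+
    then show ?thesis using tree_orientation[OF tree \<open>r \<in> W\<close>] ce2[OF W] by simp
  qed
  then obtain F where F: "\<And>W. W \<in> ?CC \<Longrightarrow> bij_betw (F W) (W - R) (comp_edges ends H W)"
    "\<And>W u. W \<in> ?CC \<Longrightarrow> u \<in> W - R \<Longrightarrow> u \<in> ends (F W u)" by metis
  define f where "f u = F (comp_of ends X H u) u" for u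
  have fF: "f u = F W u" if "W \<in> ?CC" "u \<in> W" for W u
    using component_eq_comp_of(1)[OF that] by (simp add: f_def)
  have "bij_betw f (\<Union>W\<in>?CC. W - R) (\<Union>W\<in>?CC. comp_edges ends H W)"
  proof (rule bij_betw_UNION_disjoint)
    show "disjoint_family_on (comp_edges ends H) ?CC"
      unfolding disjoint_family_on_def
    proof (intro ballI impI, rule ccontr)
      fix W W' assume WW: "W \<in> ?CC" "W' \<in> ?CC" "W \<noteq> W'" "comp_edges ends H W \<inter> comp_edges ends H W' \<noteq> {}"
      then obtain e where e: "e \<in> comp_edges ends H W" "e \<in> comp_edges ends H W'" by blast
      then obtain x where "x \<in> W" "x \<in> W'" using ce2[OF WW(1) e(1)] by (auto simp: comp_edges_def)
      then show False using component_eq_comp_of(1) WW by metis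
    qed
    show "bij_betw f (W - R) (comp_edges ends H W)" if "W \<in> ?CC" for W
      using F(1)[OF that] bij_betw_cong[of "W - R" f "F W"] fF[OF that] by blast
  qed
  moreover have "(\<Union>W\<in>?CC. W - R) = X - R"
  proof
    show "X - R \<subseteq> (\<Union>W\<in>?CC. W - R)"
      using comp_of_self by (fastforce simp: components_eq)
  qed (auto simp: components_eq comp_of_def)
  moreover have "(\<Union>W\<in>?CC. comp_edges ends H W) = H"
  proof
    show "H \<subseteq> (\<Union>W\<in>?CC. comp_edges ends H W)"
    proof
      fix e assume e: "e \<in> H"
      then obtain x y where xy: "x \<in> X" "y \<in> X" "ends e = {x, y}" using ends2 HE by blast
      have W: "comp_of ends X H x \<in> ?CC" "x \<in> comp_of ends X H x"
        using xy comp_of_self by (auto simp: components_eq)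
      then have "e \<in> comp_edges ends H (comp_of ends X H x)"
        using e xy same[OF e xy(3) W(2,1)] by (simp add: comp_edges_def)
      then show "e \<in> (\<Union>W\<in>?CC. comp_edges ends H W)" using W by blast
    qed
  qed (auto simp: comp_edges_def)
  moreover have "u \<in> ends (f u)" if "u \<in> X - R" for u
    using F(2)[of "comp_of ends X H u" u] that comp_of_self[of u X ends H] by (auto simp: f_def components_eq)
  ultimately show ?thesis by auto
qed

section \<open>Counting orientations\<close>

context orientation
begin

lemma ncycles_eq: "ncycles X p = {orbit p x | x. x \<in> X - R \<and> x \<in> orbit p x \<and> p x \<noteq> x}"
  using p_out by (auto simp: ncycles_def)

lemma finite_nonroots: "finite (X - R)"
  using finX by simp

lemma ncycle_props:
  assumes "C \<in> ncycles X p"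
  shows "C \<subseteq> X - R" "p ` C = C" "\<And>u. u \<in> C \<Longrightarrow> p u \<noteq> u" "C \<noteq> {}" "\<And>x. x \<in> C \<Longrightarrow> C = orbit p x"
proof -
  obtain x where x: "C = orbit p x" "x \<in> X - R" "x \<in> orbit p x" "p x \<noteq> x"
    using assms by (auto simp: ncycles_eq)
  show sub: "C \<subseteq> X - R" using orbit_nonroot x by simp
  show "p u \<noteq> u" if "u \<in> C" for u using periodic_not_fixed[OF x(3,4)] that x(1) by simp
  show "C \<noteq> {}" using x by auto
  show ce: "C = orbit p x" if "x \<in> C" for x using orbit_eq_if_mem[OF x(3)] that x(1) by simp
  show "p ` C = C"
  proof (rule card_subset_eq[symmetric, THEN sym])
    show "finite C" using sub finite_nonroots finite_subset by blast
    show "p ` C \<subseteq> C" using x(1) by (auto intro: orbit.step)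
    have "C \<subseteq> p ` C"
    proof
      fix z assume "z \<in> C"
      then obtain n where "z = (p ^^ Suc n) x" using x(1) by (auto simp: orbit_altdef gr0_conv_Suc)
      moreover have "(p ^^ n) x \<in> C" using funpow_in_orbit[OF x(3)] x(1) by simp
      ultimately show "z \<in> p ` C" by simp
    qed
    then show "card (p ` C) = card C" using \<open>p ` C \<subseteq> C\<close> by (metis subset_antisym)
  qed
qed

text \<open>A map of a finite set onto itself makes every point periodic, so these sets are exactly
  the unions of nontrivial cycles. They parametrize the reversals of an orientation.\<close>

lemma card_invariant_sets:
  "card {D. D \<subseteq> X - R \<and> p ` D = D \<and> (\<forall>u\<in>D. p u \<noteq> u)} = 2 ^ card (ncycles X p)"
proof -
  have "bij_betw Union (Pow (ncycles X p)) {D. D \<subseteq> X - R \<and> p ` D = D \<and> (\<forall>u\<in>D. p u \<noteq> u)}"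
    unfolding bij_betw_def
  proof
    have mono: "S \<subseteq> T" if ST: "S \<subseteq> ncycles X p" "T \<subseteq> ncycles X p" "\<Union>S \<subseteq> \<Union>T" for S T
    proof
      fix C assume C: "C \<in> S"
      then have nc: "C \<in> ncycles X p" using ST(1) by blast
      obtain x where x: "x \<in> C" using ncycle_props(4)[OF nc] by blast
      then obtain C' where C': "C' \<in> T" "x \<in> C'" using C ST(3) by blast
      then have "C = C'" using ncycle_props(5)[OF nc x] ncycle_props(5)[of C' x] ST(2) by blast
      then show "C \<in> T" using C' by simp
    qed
    then show "inj_on Union (Pow (ncycles X p))" 
    proof (intro inj_onI)
      fix S T assume "S \<in> Pow (ncycles X p)" "T \<in> Pow (ncycles X p)" "\<Union>S = \<Union>T"
      then show "S = T" using mono[of S T] mono[of T S] by simp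
    qed
    show "Union ` Pow (ncycles X p) = {D. D \<subseteq> X - R \<and> p ` D = D \<and> (\<forall>u\<in>D. p u \<noteq> u)}" (is "_ = ?DD")
    proof (intro equalityI subsetI)
      fix D assume "D \<in> Union ` Pow (ncycles X p)"
      then obtain S where S: "S \<subseteq> ncycles X p" "D = \<Union>S" by blast
      have "p ` D = (\<Union>C\<in>S. p ` C)" using S(2) by blast
      also have "\<dots> = D" using S ncycle_props(2) by (simp add: subset_iff)
      finally show "D \<in> ?DD" using S ncycle_props(1,3) by blast
    next
      fix D assume D: "D \<in> ?DD"
      then have "finite D" using finite_nonroots finite_subset by blast
      then have per: "x \<in> orbit p x" if "x \<in> D" for x
        using orbit_self_if_image_eq[of D p x] D that by simp
      have sub: "orbit p x \<subseteq> D" if "x \<in> D" for x using D that by (intro orbit_image_subset) auto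
      have "D = \<Union> (orbit p ` D)" using per sub by blast
      moreover have "orbit p ` D \<subseteq> ncycles X p" using D per by (auto simp: ncycles_eq)
      ultimately show "D \<in> Union ` Pow (ncycles X p)" by blast
    qed
  qed
  then show ?thesis
    using bij_betw_same_card card_Pow[OF finite_ncycles[OF finX, of p]] by fastforce
qed

text \<open>An orientation g of the same edge set H differs from f exactly on a union of nontrivial
  cycles of p, all of which it traverses in the opposite direction.\<close>

lemma reversed_set:
  assumes g: "g ` (X - R) = H" "\<And>u. u \<in> X - R \<Longrightarrow> u \<in> ends (g u)"
  defines "D \<equiv> {u \<in> X - R. g u \<noteq> f u}"
  shows "p ` D = D" "\<And>u. u \<in> D \<Longrightarrow> p u \<noteq> u" "inj_on p D" "\<And>v. v \<in> D \<Longrightarrow> g (p v) = f v"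
proof -
  have finD: "finite D" unfolding D_def by (rule finite_subset[OF _ finite_nonroots]) auto
  have "card (g ` (X - R)) = card (X - R)" using g(1) bij by (simp add: bij_betw_same_card)
  then have g_inj: "inj_on g (X - R)" using finite_nonroots by (simp add: eq_card_imp_inj_on)
  \<comment> \<open>Under \<open>f\<close> the edge \<open>g u\<close> is owned by its other end v,
    so \<open>p v = u\<close>; and v has changed its edge too, since \<open>g\<close> is injective.
    This gives one inclusion for \<open>p\<close> on \<open>D\<close>, and finiteness gives
    equality.\<close>
  have ex: "\<exists>v\<in>D. p v = u \<and> g u = f v \<and> v \<noteq> u" if u: "u \<in> D" for u
  proof -
    have uX: "u \<in> X - R" "g u \<noteq> f u" using u by (auto simp: D_def)
    have "g u \<in> H" using g(1) uX by blast
    then obtain v where v: "v \<in> X - R" "g u = f v" "ends (g u) = {v, p v}" by (elim edgeE) simp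
    have "v \<noteq> u" using v uX by auto
    then have "p v = u" using g(2)[OF uX(1)] v by auto
    moreover have "g v \<noteq> f v" using inj_onD[OF g_inj, of v u] v uX \<open>v \<noteq> u\<close> by metis
    ultimately show ?thesis using v \<open>v \<noteq> u\<close> by (auto simp: D_def)
  qed
  then have sub: "D \<subseteq> p ` D" by blast
  have "card (p ` D) \<le> card D" using finD by (rule card_image_le)
  then have "D = p ` D" using sub finD by (intro card_seteq) auto
  then show pD: "p ` D = D" by simp
  then show inj: "inj_on p D" using finD by (simp add: eq_card_imp_inj_on)
  show "p u \<noteq> u" if u: "u \<in> D" for u
  proof
    assume "p u = u"
    moreover obtain v where "v \<in> D" "p v = u" "v \<noteq> u" using ex[OF u] by blast
    ultimately show False using inj_onD[OF inj, of u v] u by auto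
  qed
  show "g (p v) = f v" if v: "v \<in> D" for v
  proof -
    have "p v \<in> D" using v pD by blast
    then obtain v' where "v' \<in> D" "p v' = p v" "g (p v) = f v'" using ex by metis
    then show ?thesis using inj_onD[OF inj] v by metis
  qed
qed

text \<open>Relative to \<open>f\<close>, an orientation is determined by the set of vertices where
  it deviates, and that set can be any union of nontrivial cycles. Loops and root components leave
  no freedom.\<close>

lemma card_orientations:
  assumes "H \<subseteq> E"
  shows "card {g \<in> Pi\<^sub>E (X - R) (\<lambda>u. {e \<in> E. u \<in> ends e}). g ` (X - R) = H} = 2 ^ card (ncycles X p)"
    (is "card ?G = _")
proof -
  let ?D = "\<lambda>g. {u \<in> X - R. g u \<noteq> f u}"
  let ?DD = "{D. D \<subseteq> X - R \<and> p ` D = D \<and> (\<forall>u\<in>D. p u \<noteq> u)}"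
  have inc: "u \<in> ends (g u)" if "g \<in> ?G" "u \<in> X - R" for g u using that by auto
  have rev: "p ` ?D g = ?D g" "\<And>u. u \<in> ?D g \<Longrightarrow> p u \<noteq> u" "\<And>v. v \<in> ?D g \<Longrightarrow> g (p v) = f v" if g: "g \<in> ?G" for g
  proof -
    have img: "g ` (X - R) = H" using g by simp
    show "p ` ?D g = ?D g" by (rule reversed_set(1)[OF img inc[OF g]])
    show "p u \<noteq> u" if "u \<in> ?D g" for u by (rule reversed_set(2)[OF img inc[OF g] that])
    show "g (p v) = f v" if "v \<in> ?D g" for v by (rule reversed_set(4)[OF img inc[OF g] that])
  qed
  have "inj_on ?D ?G"
  proof (rule inj_onI)
    fix g g' assume gg: "g \<in> ?G" "g' \<in> ?G" "?D g = ?D g'"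
    show "g = g'"
    proof (rule PiE_ext)
      show "g \<in> Pi\<^sub>E (X - R) (\<lambda>u. {e \<in> E. u \<in> ends e})" "g' \<in> Pi\<^sub>E (X - R) (\<lambda>u. {e \<in> E. u \<in> ends e})"
        using gg by auto
      fix u assume u: "u \<in> X - R"
      show "g u = g' u"
      proof (cases "u \<in> ?D g")
        case True
        have "u \<in> p ` ?D g" using True unfolding rev(1)[OF gg(1)] .
        then obtain v where v: "v \<in> ?D g" "p v = u" by (elim imageE) simp
        have "g (p v) = f v" by (rule rev(3)[OF gg(1) v(1)])
        moreover have "v \<in> ?D g'" using v(1) unfolding gg(3) .
        then have "g' (p v) = f v" by (rule rev(3)[OF gg(2)])
        ultimately show ?thesis using v by simp
      next
        case False
        then have "u \<notin> ?D g'" unfolding gg(3) .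
        then show ?thesis using False u by auto
      qed
    qed
  qed
  moreover have "?D ` ?G = ?DD"
  proof (intro equalityI subsetI)
    fix D assume "D \<in> ?D ` ?G"
    then obtain g where g: "g \<in> ?G" "D = ?D g" by blast
    have "p ` D = D" unfolding g(2) by (rule rev(1)[OF g(1)])
    moreover have "p u \<noteq> u" if "u \<in> D" for u using that unfolding g(2) by (rule rev(2)[OF g(1)])
    ultimately show "D \<in> ?DD" using g(2) by auto
  next
    fix D assume D: "D \<in> ?DD"
    then have sub: "D \<subseteq> X - R" and pD: "p ` D = D" and nfix: "\<And>u. u \<in> D \<Longrightarrow> p u \<noteq> u" by auto
    have "finite D" using sub finite_nonroots finite_subset by blast
    \<comment> \<open>On a reversed cycle each vertex takes the edge of its predecessor, hence the
      inverse of \<open>p\<close> on \<open>D\<close>.\<close>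
    define q where "q = inv_into D p"
    have q: "q u \<in> D" "p (q u) = u" if "u \<in> D" for u
      unfolding q_def using that pD by (auto intro!: inv_into_into f_inv_into_f)
    have qimg: "q ` D = D"
    proof
      show "D \<subseteq> q ` D"
      proof
        fix u assume u: "u \<in> D"
        have "inj_on p D" using pD \<open>finite D\<close> by (simp add: eq_card_imp_inj_on)
        then have "q (p u) = u" unfolding q_def using u by simp
        moreover have "p u \<in> D" using u pD by blast
        ultimately show "u \<in> q ` D" by (metis imageI)
      qed
    qed (use q in blast)
    define g where "g = (\<lambda>u\<in>X - R. if u \<in> D then f (q u) else f u)"
    have "g ` (X - R) = f ` q ` D \<union> f ` (X - R - D)"
      using sub by (auto simp: g_def image_iff)
    also have "\<dots> = f ` (X - R)" unfolding qimg using sub by blast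
    also have "\<dots> = H" using bij by (simp add: bij_betw_def)
    finally have img: "g ` (X - R) = H" .
    have "u \<in> ends (g u)" if u: "u \<in> X - R" for u
    proof (cases "u \<in> D")
      case True
      then have "q u \<in> X - R" "p (q u) = u" using q sub by auto
      then show ?thesis using True u ends_f[of "q u"] by (simp add: g_def)
    qed (use u ends_f in \<open>simp add: g_def\<close>)
    moreover have "g u \<in> E" if "u \<in> X - R" for u using img assms that by blast
    moreover have "g \<in> extensional (X - R)" by (simp add: g_def)
    ultimately have "g \<in> ?G" using img by (simp add: PiE_def Pi_def)
    moreover have "?D g = D"
    proof -
      have "f (q u) \<noteq> f u" if u: "u \<in> D" for u
      proof
        assume "f (q u) = f u"
        then have "q u = u" using u q(1)[OF u] sub by (intro f_inj) auto
        then show False using q(2)[OF u] nfix[OF u] by simp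
      qed
      then show ?thesis using sub by (auto simp: g_def)
    qed
    ultimately show "D \<in> ?D ` ?G" by blast
  qed
  ultimately have "card ?G = card ?DD" by (intro bij_betw_same_card[of ?D]) (simp add: bij_betw_def)
  then show ?thesis using card_invariant_sets by simp
qed

text \<open>An odd length other than 1 is at least 3. Components are matched with cycles through
  their sets of periodic points.\<close>

lemma card_long_cycle_components:
  assumes "\<And>x. x \<in> X - R \<Longrightarrow> x \<in> orbit p x \<Longrightarrow> odd (card (orbit p x))"
  shows "card {W \<in> components ends X H. \<exists>Cy. is_cycle ends (comp_edges ends H W) Cy \<and> card Cy \<ge> 3}
    = card (ncycles X p)"
proof -
  let ?P = "\<lambda>W. {x \<in> W. x \<in> orbit p x}"
  let ?B = "{W \<in> components ends X H. \<exists>Cy. is_cycle ends (comp_edges ends H W) Cy \<and> card Cy \<ge> 3}"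
  have P: "?P W = orbit p x" if W: "W \<in> components ends X H" "x \<in> W" "x \<in> X - R" "x \<in> orbit p x" for W x
  proof -
    have "z \<in> orbit p z" if "z \<in> orbit p x" for z using self_in_orbit_trans[OF W(4) that] .
    then show ?thesis using orbit_cycle_in_component(2)[OF W] component_periodic_unique[OF W(1,2) _ W(4)]
      by blast
  qed
  have "inj_on ?P ?B"
  proof (rule inj_onI)
    fix W W' assume WW: "W \<in> ?B" "W' \<in> ?B" "?P W = ?P W'"
    then obtain x where "x \<in> ?P W" using component_periodic[of W] by blast
    moreover from this have "x \<in> ?P W'" using WW(3) by simp
    ultimately have "x \<in> W" "x \<in> W'" by auto
    moreover have "W \<in> components ends X H" "W' \<in> components ends X H" using WW by auto
    ultimately show "W = W'" using component_eq_comp_of(1) by metis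
  qed
  moreover have "?P ` ?B = ncycles X p"
  proof (intro equalityI subsetI)
    fix C assume "C \<in> ?P ` ?B"
    then obtain W Cy where W: "W \<in> components ends X H" "C = ?P W"
      "is_cycle ends (comp_edges ends H W) Cy" "card Cy \<ge> 3" by blast
    obtain x where x: "x \<in> W" "x \<in> X - R" "x \<in> orbit p x" "card Cy = card (orbit p x)"
      using comp_edges_cycle[OF W(1,3)] by metis
    have "orbit p x \<noteq> {x}" using x(4) W(4) by auto
    then have "p x \<noteq> x" by (simp add: orbit_eq_singleton_iff)
    then show "C \<in> ncycles X p" using P[OF W(1) x(1-3)] W(2) x by (auto simp: ncycles_eq)
  next
    fix C assume "C \<in> ncycles X p"
    then obtain x where x: "C = orbit p x" "x \<in> X - R" "x \<in> orbit p x" "p x \<noteq> x"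
      by (auto simp: ncycles_eq)
    define W where "W = comp_of ends X H x"
    have W: "W \<in> components ends X H" "x \<in> W" using x comp_of_self by (auto simp: W_def components_eq)
    have "card (orbit p x) \<noteq> 1"
      using x(3,4) orbit_eq_singleton_iff[of p x] by (metis card_1_singletonE singletonD)
    then have "card (orbit p x) \<ge> 3" using assms[OF x(2,3)]
      by (cases "card (orbit p x)" rule: nat.exhaust) (auto simp: le_Suc_eq not_less_eq_eq numeral_3_eq_3 elim: oddE)
    then have "W \<in> ?B"
      using orbit_cycle_in_component(1)[OF W x(2,3)] cycle_of_orbit(2)[OF x(2,3)] W(1) by auto
    then show "C \<in> ?P ` ?B" using P[OF W x(2,3)] x(1) by blast
  qed
  ultimately show ?thesis by (intro bij_betw_same_card[of ?P]) (simp add: bij_betw_def)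
qed

text \<open>The number of \<open>p\<close>-steps to \<open>m\<close> changes by exactly 1 across
  every edge, since the owner of an edge is never the root \<open>m\<close>. So all walks from
  \<open>l\<close> to \<open>m\<close> have the same parity, the shortest one included, and no path
  has to be identified.\<close>

lemma gdist_parity:
  assumes m: "m \<in> R" and l: "\<exists>k. (p ^^ k) l = m"
  shows "even (gdist ends H l m + (LEAST k. (p ^^ k) l = m))"
proof -
  define reach where "reach x \<longleftrightarrow> (\<exists>k. (p ^^ k) x = m)" for x
  define d where "d x = (LEAST k. (p ^^ k) x = m)" for x
  have reach_p: "reach (p u) \<longleftrightarrow> reach u" if um: "u \<noteq> m" for u
  proof
    assume "reach u"
    then obtain k where k: "(p ^^ k) u = m" unfolding reach_def by blast
    then obtain k' where "k = Suc k'" using um by (cases k) auto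
    then show "reach (p u)" using k unfolding reach_def by (auto simp: funpow_swap1)
  next
    assume "reach (p u)"
    then obtain k where "(p ^^ k) (p u) = m" unfolding reach_def by blast
    then have "(p ^^ Suc k) u = m" by (simp add: funpow_swap1)
    then show "reach u" unfolding reach_def by blast
  qed
  have d_p: "d u = Suc (d (p u))" if u: "u \<noteq> m" "reach u" for u
  proof -
    obtain k where "(p ^^ k) u = m" using u(2) unfolding reach_def by blast
    then have "(LEAST k. (p ^^ k) u = m) = Suc (LEAST k. (p ^^ Suc k) u = m)"
      using u(1) by (intro Least_Suc) auto
    then show ?thesis by (simp add: d_def funpow_swap1)
  qed
  \<comment> \<open>Reachability is carried along because \<open>d\<close> is meaningful only for
    vertices that reach \<open>m\<close>.\<close>
  have walk: "(x, y) \<in> adj ends H ^^ n \<Longrightarrow> reach x \<Longrightarrow> reach y \<and> even (n + d x + d y)" for x y n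
  proof (induction n arbitrary: y)
    case (Suc n)
    obtain z where z: "(x, z) \<in> adj ends H ^^ n" "(z, y) \<in> adj ends H" using Suc.prems(1) by auto
    then have IH: "reach z" "even (n + d x + d z)" using Suc by auto
    obtain e where e: "e \<in> H" "ends e = {z, y}" using z(2) unfolding adj_def by blast
    obtain u where u: "u \<in> X - R" "ends e = {u, p u}" using edgeE[OF e(1)] by metis
    have "u \<noteq> m" using u m by blast
    have "z = u \<and> y = p u \<or> z = p u \<and> y = u" using e u by (auto simp: doubleton_eq_iff)
    then show ?case
      using IH d_p[OF \<open>u \<noteq> m\<close>] reach_p[OF \<open>u \<noteq> m\<close>] by (elim disjE) auto
  qed simp
  have rl: "reach l" using l by (simp add: reach_def)
  obtain k where k: "(p ^^ k) l = m" using l by blast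
  have "(l, m) \<in> (adj ends H)\<^sup>*" using funpow_adj[of l k] k by simp
  then have "\<exists>n. (l, m) \<in> adj ends H ^^ n" by (rule rtrancl_imp_relpow)
  then have "(l, m) \<in> adj ends H ^^ gdist ends H l m" unfolding gdist_def by (rule LeastI_ex)
  then have "even (gdist ends H l m + d l + d m)" using walk rl by blast
  moreover have "d m = 0" unfolding d_def by (intro Least_eq_0) simp
  ultimately show ?thesis by (simp add: d_def)
qed

end

section \<open>Determinants as sums over rooted families\<close>

lemma unit_row_self: "unit_row u u = 1"
  by (simp add: unit_row_def)

lemma det_on_unit:
  assumes "finite X"
  shows "det_on X (unit_row :: 'v \<Rightarrow> 'v \<Rightarrow> 'a::comm_ring_1) = 1"
proof -
  have "det_on X (unit_row :: 'v \<Rightarrow> 'v \<Rightarrow> 'a) = (if a \<in> X then unit_row a a else 1)" for a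
    using assms by (rule det_on_unit_rows_except) (simp add: unit_row_def)
  from this[of undefined] show ?thesis by (simp add: unit_row_self)
qed

text \<open>Row \<open>l\<close> of \<open>K\<close> times \<open>N\<close> is e_l. Replacing row
  \<open>m\<close> of \<open>N\<close> by e_l therefore amounts to multiplying \<open>N\<close> from
  the left by the identity matrix with row \<open>m\<close> replaced by \<open>K l\<close>, whose
  determinant is \<open>K l m\<close>.\<close>

lemma cramer_row:
  fixes N :: "'v \<Rightarrow> 'v \<Rightarrow> 'a::{idom,ring_char_0}"
  assumes X: "finite X" and inv: "\<And>u v. u \<in> X \<Longrightarrow> v \<in> X \<Longrightarrow> (\<Sum>x\<in>X. K u x * N x v) = unit_row u v"
  shows "det_on X N \<noteq> 0" "l \<in> X \<Longrightarrow> m \<in> X \<Longrightarrow> det_on X (N(m := unit_row l)) = K l m * det_on X N"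
proof -
  have "det_on X K * det_on X N = det_on X unit_row"
    unfolding det_on_mult[OF X, symmetric] by (rule det_on_cong) (simp add: inv)
  then show "det_on X N \<noteq> 0" by (auto simp: det_on_unit[OF X])
  assume lm: "l \<in> X" "m \<in> X"
  define C where "C = (unit_row :: 'v \<Rightarrow> 'v \<Rightarrow> 'a)(m := K l)"
  have "det_on X (N(m := unit_row l)) = det_on X (\<lambda>u v. \<Sum>x\<in>X. C u x * N x v)"
  proof (rule det_on_cong)
    fix u v assume uv: "u \<in> X" "v \<in> X"
    show "(N(m := unit_row l)) u v = (\<Sum>x\<in>X. C u x * N x v)"
    proof (cases "u = m")
      case True
      then show ?thesis using inv[OF lm(1) uv(2)] by (simp add: C_def)
    next
      case False
      have "(\<Sum>x\<in>X. C u x * N x v) = (\<Sum>x\<in>X. if x = u then N x v else 0)"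
        using False by (intro sum.cong) (auto simp: C_def unit_row_def)
      then show ?thesis using False X uv by simp
    qed
  qed
  also have "\<dots> = det_on X C * det_on X N" by (rule det_on_mult[OF X])
  also have "det_on X C = K l m"
    using det_on_unit_rows_except[OF X, of m C] lm by (auto simp: C_def unit_row_def)
  finally show "det_on X (N(m := unit_row l)) = K l m * det_on X N" .
qed

section \<open>Edge choices and the determinants they contribute\<close>

fun jsign :: "jtype \<Rightarrow> complex" where
  "jsign JL = - 1"
| "jsign JQ = 1"

text \<open>Length 1 is excluded because for L the power is 1 although a loop is admissible.\<close>

lemma jsign_power_iff:
  assumes "k \<noteq> 1"
  shows "(- jsign J) ^ k = 1 \<longleftrightarrow> \<not> cycle_len_ok J k"
  using assms by (cases J; cases "even k") auto

definition other_end :: "('e \<Rightarrow> 'v set) \<Rightarrow> 'e \<Rightarrow> 'v \<Rightarrow> 'v" where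
  "other_end ends e u = (THE v. ends e = {u, v})"

lemma other_end_eq: "ends e = {u, v} \<Longrightarrow> other_end ends e u = v"
  unfolding other_end_def by (rule the_equality) (auto simp: doubleton_eq_iff)

definition succ_map :: "('e \<Rightarrow> 'v set) \<Rightarrow> 'v set \<Rightarrow> ('v \<Rightarrow> 'e) \<Rightarrow> 'v \<Rightarrow> 'v" where
  "succ_map ends U f u = (if u \<in> U then other_end ends (f u) u else u)"

definition choices :: "('e \<Rightarrow> 'v set) \<Rightarrow> 'v set \<Rightarrow> 'e set \<Rightarrow> ('v \<Rightarrow> 'e) set" where
  "choices ends U E = Pi\<^sub>E U (\<lambda>u. {e \<in> E. u \<in> ends e})"

definition long_cycles :: "jtype \<Rightarrow> ('e \<Rightarrow> 'v set) \<Rightarrow> 'v set \<Rightarrow> 'e set \<Rightarrow> nat" where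
  "long_cycles J ends X H = (case J of JL \<Rightarrow> 0 | JQ \<Rightarrow>
     card {W \<in> components ends X H. \<exists>Cy. is_cycle ends (comp_edges ends H W) Cy \<and> card Cy \<ge> 3})"

locale rooted_graph =
  fixes ends :: "'e \<Rightarrow> 'v set" and X R :: "'v set" and E :: "'e set"
  assumes finX: "finite X" and RX: "R \<subseteq> X" and finE: "finite E"
    and ends2: "e \<in> E \<Longrightarrow> \<exists>x\<in>X. \<exists>y\<in>X. ends e = {x, y}"
begin

lemma succ_map_props:
  assumes "f \<in> choices ends (X - R) E"
  shows "u \<in> X - R \<Longrightarrow> ends (f u) = {u, succ_map ends (X - R) f u}"
    and "u \<in> X - R \<Longrightarrow> succ_map ends (X - R) f u \<in> X"
    and "u \<notin> X - R \<Longrightarrow> succ_map ends (X - R) f u = u"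
proof -
  have "ends (f u) = {u, succ_map ends (X - R) f u} \<and> succ_map ends (X - R) f u \<in> X" if u: "u \<in> X - R"
  proof -
    have fu: "f u \<in> E" "u \<in> ends (f u)" using assms u by (auto simp: choices_def)
    obtain x y where "x \<in> X" "y \<in> X" "ends (f u) = {x, y}" using ends2[OF fu(1)] by blast
    then obtain v where "v \<in> X" "ends (f u) = {u, v}" using fu(2) by (auto simp: insert_commute)
    then show ?thesis using u other_end_eq[of ends "f u" u v] by (simp add: succ_map_def)
  qed
  then show "u \<in> X - R \<Longrightarrow> ends (f u) = {u, succ_map ends (X - R) f u}"
    "u \<in> X - R \<Longrightarrow> succ_map ends (X - R) f u \<in> X" by auto
qed (auto simp: succ_map_def)

lemma orientation_succ_map:
  assumes "f \<in> choices ends (X - R) E" "inj_on f (X - R)"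
  shows "orientation ends X R f (succ_map ends (X - R) f) (f ` (X - R))"
  using succ_map_props[OF assms(1)] assms(2) finX RX
  by unfold_locales (auto simp: bij_betw_def)

lemma choices_image_subset: "f \<in> choices ends (X - R) E \<Longrightarrow> f ` (X - R) \<subseteq> E"
  by (auto simp: choices_def)

lemma succ_map_image: "f \<in> choices ends (X - R) E \<Longrightarrow> succ_map ends (X - R) f ` X \<subseteq> X"
  using succ_map_props(2,3) by (intro image_subsetI) (metis (no_types))

lemma card_orbit_neq_1: "p x \<noteq> x \<Longrightarrow> x \<in> orbit p x \<Longrightarrow> card (orbit p x) \<noteq> 1"
  using orbit_eq_singleton_iff[of p x] by (metis card_1_singletonE singletonD)

lemma det_on_choice:
  assumes f: "f \<in> choices ends (X - R) E"
  defines "p \<equiv> succ_map ends (X - R) f" and "H \<equiv> f ` (X - R)"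
  shows "det_on X (fmat (jsign J) p) =
    (if inj_on f (X - R) \<and> H \<in> rooted_family J ends X R E then 2 ^ long_cycles J ends X H else 0)"
proof -
  have val: "det_on X (fmat (jsign J) p) =
    (if \<exists>C\<in>ncycles X p. (- jsign J) ^ card C = 1 then 0 else 2 ^ card (ncycles X p))"
    using succ_map_image[OF f] by (intro det_on_fmat finX) (auto simp: p_def intro: jsign.elims)
  show ?thesis
  proof (cases "inj_on f (X - R)")
    case False
    \<comment> \<open>Two vertices that chose the same edge are swapped by the successor map, and
      the factor of a 2-cycle vanishes for both signs.\<close>
    then obtain u v where uv: "u \<in> X - R" "v \<in> X - R" "u \<noteq> v" "f u = f v" by (auto simp: inj_on_def)
    then have "{u, p u} = {v, p v}" using succ_map_props(1)[OF f] unfolding p_def by metis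
    then have p: "p u = v" "p v = u" using uv(3) by (auto simp: doubleton_eq_iff)
    have orb: "orbit p u = {u, v}"
    proof
      show "orbit p u \<subseteq> {u, v}" using p by (intro orbit_image_subset) auto
      show "{u, v} \<subseteq> orbit p u" using p orbit.base[of p u] orbit.step[OF orbit.base, of p u] by simp
    qed
    then have "{u, v} \<in> ncycles X p" using uv p by (auto simp: ncycles_def)
    moreover have "(- jsign J) ^ card {u, v} = 1" using uv(3) by (cases J) auto
    ultimately show ?thesis using val False by auto
  next
    case True
    interpret orientation ends X R f p H
      unfolding p_def H_def using orientation_succ_map[OF f True] .
    have HE: "H \<subseteq> E" using choices_image_subset[OF f] by (simp add: H_def)
    have fam: "H \<in> rooted_family J ends X R E \<longleftrightarrow> \<not> (\<exists>C\<in>ncycles X p. (- jsign J) ^ card C = 1)" (is "_ \<longleftrightarrow> \<not> ?bad")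
    proof -
      have "cycle_len_ok J (card (orbit p x))" if "p x = x" for x
        using that orbit_eq_singleton_iff[of p x] by (cases J) auto
      then have "(\<forall>x\<in>X - R. x \<in> orbit p x \<longrightarrow> cycle_len_ok J (card (orbit p x))) \<longleftrightarrow>
          (\<forall>x\<in>X - R. x \<in> orbit p x \<longrightarrow> p x \<noteq> x \<longrightarrow> (- jsign J) ^ card (orbit p x) \<noteq> 1)"
        using jsign_power_iff card_orbit_neq_1 by metis
      also have "\<dots> \<longleftrightarrow> \<not> ?bad" unfolding ncycles_eq by blast
      finally show ?thesis using rooted_family_iff[OF HE, of J] by simp
    qed
    have "long_cycles J ends X H = card (ncycles X p)" if good: "\<not> ?bad"
    proof (cases J)
      case JL
      \<comment> \<open>For L the base of the power is 1, so every nontrivial cycle would be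
        bad.\<close>
      then have "ncycles X p = {}" using good by auto
      then show ?thesis using JL by (simp add: long_cycles_def)
    next
      case JQ
      have "odd (card (orbit p x))" if "x \<in> X - R" "x \<in> orbit p x" for x
        using that good fam rooted_family_iff[OF HE, of JQ] JQ by simp
      then show ?thesis using card_long_cycle_components JQ by (simp add: long_cycles_def)
    qed
    then show ?thesis using val fam True by auto
  qed
qed

lemma finite_choices: "finite (choices ends (X - R) E)"
  unfolding choices_def using finX finE by (intro finite_PiE) auto

text \<open>One existing orientation serves as reference, and the others are its reversals.
  Injectivity is a count: \<open>H\<close> has as many edges as there are non-root vertices.\<close>

lemma card_choices:
  assumes H: "H \<in> rooted_family J ends X R E"
  shows "card {f \<in> choices ends (X - R) E. f ` (X - R) = H} = 2 ^ long_cycles J ends X H"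
    and "\<And>f. f ` (X - R) = H \<Longrightarrow> inj_on f (X - R)"
proof -
  obtain f0 where f0: "bij_betw f0 (X - R) H" "\<And>u. u \<in> X - R \<Longrightarrow> u \<in> ends (f0 u)"
    using rooted_family_orientation[OF H ends2] by blast
  have HE: "H \<subseteq> E" using H by (simp add: rooted_family_def)
  define f where "f = restrict f0 (X - R)"
  have img: "f ` (X - R) = H" using f0(1) by (simp add: f_def bij_betw_def)
  have inj: "inj_on f (X - R)" using f0(1) by (simp add: f_def bij_betw_def)
  have f: "f \<in> choices ends (X - R) E"
    using img HE f0(2) by (auto simp: choices_def f_def)
  define p where "p = succ_map ends (X - R) f"
  interpret orientation ends X R f p H
    unfolding p_def using orientation_succ_map[OF f inj] img by simp
  \<comment> \<open>Two evaluations of the same determinant identify \<open>long_cycles\<close> with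
    the number of nontrivial cycles, for L and Q at once.\<close>
  have "det_on X (fmat (jsign J) p) = 2 ^ long_cycles J ends X H"
    using det_on_choice[OF f, of J] inj img H by (simp add: p_def)
  moreover have "det_on X (fmat (jsign J) p) =
    (if \<exists>C\<in>ncycles X p. (- jsign J) ^ card C = 1 then 0 else 2 ^ card (ncycles X p))"
    using p_image by (intro det_on_fmat finX) (auto intro: jsign.elims)
  ultimately have "(2 :: complex) ^ long_cycles J ends X H = 2 ^ card (ncycles X p)" by (auto split: if_splits)
  then have "of_nat (2 ^ long_cycles J ends X H) = (of_nat (2 ^ card (ncycles X p)) :: complex)" by simp
  then have "2 ^ long_cycles J ends X H = (2 :: nat) ^ card (ncycles X p)" unfolding of_nat_eq_iff .
  then show "card {f \<in> choices ends (X - R) E. f ` (X - R) = H} = 2 ^ long_cycles J ends X H"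
    using card_orientations[OF HE] by (simp add: choices_def)
  have "card H = card (X - R)" using img card_image[OF inj] by simp
  then show "inj_on g (X - R)" if "g ` (X - R) = H" for g
    using that finX by (intro eq_card_imp_inj_on) auto
qed

text \<open>The common part of numerator and denominator. The factor \<phi> has to depend on the
  edge set only where the determinant does not vanish; it is 1 for the denominator and the walk sign
  for the numerator.\<close>

lemma sum_choices:
  assumes \<phi>: "\<And>f. f \<in> choices ends (X - R) E \<Longrightarrow> inj_on f (X - R) \<Longrightarrow>
      f ` (X - R) \<in> rooted_family J ends X R E \<Longrightarrow> \<phi> f = \<psi> (f ` (X - R))"
  shows "(\<Sum>f\<in>choices ends (X - R) E. (\<Prod>u\<in>X - R. wt (f u)) *
        (\<phi> f * det_on X (fmat (jsign J) (succ_map ends (X - R) f))))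
    = (\<Sum>H\<in>rooted_family J ends X R E. 4 ^ long_cycles J ends X H * \<psi> H * (\<Prod>e\<in>H. wt e))"
    (is "(\<Sum>f\<in>?F. ?t f) = (\<Sum>H\<in>?R. ?s H)")
proof -
  let ?S = "{f \<in> ?F. inj_on f (X - R) \<and> f ` (X - R) \<in> ?R}"
  have "(\<Sum>f\<in>?F. ?t f) = (\<Sum>f\<in>?S. ?t f)"
    using finite_choices by (intro sum.mono_neutral_right) (auto simp: det_on_choice)
  also have "\<dots> = (\<Sum>H\<in>?R. \<Sum>f\<in>{f \<in> ?S. f ` (X - R) = H}. ?t f)"
  proof (rule sum.group[symmetric])
    show "finite ?R" by (rule finite_subset[of _ "Pow E"]) (auto simp: rooted_family_def finE)
  qed (use finite_choices in auto)
  also have "\<dots> = (\<Sum>H\<in>?R. ?s H)"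
  proof (rule sum.cong[OF refl])
    fix H assume H: "H \<in> ?R"
    have "(\<Sum>f\<in>{f \<in> ?S. f ` (X - R) = H}. ?t f) =
        (\<Sum>f\<in>{f \<in> ?F. f ` (X - R) = H}. 2 ^ long_cycles J ends X H * \<psi> H * (\<Prod>e\<in>H. wt e))"
    proof (rule sum.cong)
      show "{f \<in> ?S. f ` (X - R) = H} = {f \<in> ?F. f ` (X - R) = H}"
        using H card_choices(2)[OF H] by blast
      fix f assume f: "f \<in> {f \<in> ?F. f ` (X - R) = H}"
      then have inj: "inj_on f (X - R)" using card_choices(2)[OF H] by blast
      have "(\<Prod>u\<in>X - R. wt (f u)) = (\<Prod>e\<in>H. wt e)"
        using f prod.reindex[OF inj, of wt] by simp
      moreover have "\<phi> f = \<psi> H" using \<phi>[of f] f inj H by simp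
      moreover have "det_on X (fmat (jsign J) (succ_map ends (X - R) f)) = 2 ^ long_cycles J ends X H"
        using det_on_choice[of f J] f inj H by simp
      ultimately show "?t f = 2 ^ long_cycles J ends X H * \<psi> H * (\<Prod>e\<in>H. wt e)" by simp
    qed
    also have "\<dots> = 2 ^ long_cycles J ends X H * (2 ^ long_cycles J ends X H * \<psi> H * (\<Prod>e\<in>H. wt e))"
      using card_choices(1)[OF H] by simp
    also have "\<dots> = ?s H" by (simp flip: power_mult_distrib mult.assoc)
    finally show "(\<Sum>f\<in>{f \<in> ?S. f ` (X - R) = H}. ?t f) = ?s H" .
  qed
  finally show ?thesis .
qed

text \<open>The number of \<open>p\<close>-steps belongs to the orientation, the distance to the
  edge set; the sign needs only their common parity. A root is fixed by \<open>p\<close>, so meeting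
  its forward orbit means reaching it.\<close>

lemma root_walk_sign:
  assumes f: "f \<in> choices ends (X - R) E" "inj_on f (X - R)" and m: "m \<in> R" and l: "l \<in> X"
  defines "p \<equiv> succ_map ends (X - R) f" and "H \<equiv> f ` (X - R)"
  shows "(if \<exists>k. (p ^^ k) l = m then (- jsign J) ^ (LEAST k. (p ^^ k) l = m) else 0) =
    (if l \<in> comp_of ends X H m then (- jsign J) ^ gdist ends H l m else 0)"
proof -
  interpret orientation ends X R f p H
    unfolding p_def H_def using orientation_succ_map[OF f] .
  have "l \<in> comp_of ends X H m \<longleftrightarrow> (l, m) \<in> (adj ends H)\<^sup>*"
    using l by (auto simp: comp_of_def intro: adj_rtrancl_sym)
  also have "\<dots> \<longleftrightarrow> (\<exists>k. (p ^^ k) l = m)"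
    unfolding connected_iff by (simp add: funpow_root[OF m])
  finally have iff: "l \<in> comp_of ends X H m \<longleftrightarrow> (\<exists>k. (p ^^ k) l = m)" .
  have "(- jsign J) ^ a = (- jsign J) ^ b" if "even (a + b)" for a b :: nat
    using that by (cases J; cases "even a") auto
  then show ?thesis using gdist_parity[OF m, of l] iff by (metis add.commute)
qed

end

section \<open>The boundary value problem on a symmetric digraph\<close>

lemma HJ1_eq_rooted_family:
  "HJ1 J X dX A org tgt rv = rooted_family J (dends org tgt) X dX (deformed_edges X dX A rv)"
  by (simp add: HJ1_def rooted_family_def)

text \<open>Keeping the boundary vertices as unit rows makes every boundary vertex a fixed point of the
  functional graphs, so boundary vertices and self-loops need no separate treatment.\<close>

definition boundary_matrix where
  "boundary_matrix X dX A org tgt rv w V z u v =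
    (if u \<in> X - dX then MV A org tgt rv w V u v - (if u = v then z else 0) else unit_row u v)"

context
  fixes X :: "'v set" and A :: "'a set" and org tgt :: "'a \<Rightarrow> 'v" and rv :: "'a \<Rightarrow> 'a"
    and w :: "'a set \<Rightarrow> complex" and V :: "'v \<Rightarrow> complex" and z :: complex
  assumes graph: "symmetric_digraph X A org tgt rv"
begin

lemma finite_X: "finite X" and finite_A: "finite A"
  using graph by (auto simp: symmetric_digraph_def)

lemma arc:
  assumes "a \<in> A"
  shows "org a \<in> X" "tgt a \<in> X" "rv a \<in> A" "org (rv a) = tgt a" "tgt (rv a) = org a"
    "rv (rv a) = a" "org a \<noteq> tgt a"
  using graph assms by (auto simp: symmetric_digraph_def)

lemma dends_uedge: "a \<in> A \<Longrightarrow> dends org tgt (DE (uedge rv a)) = {tgt a, org a}"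
  using arc by (auto simp: uedge_def)

lemma rooted_graph_deformed:
  assumes "dX \<subseteq> X"
  shows "rooted_graph (dends org tgt) X dX (deformed_edges X dX A rv)"
proof
  show "finite (deformed_edges X dX A rv)"
    using finite_X finite_A by (simp add: deformed_edges_def uedges_def)
  fix e assume "e \<in> deformed_edges X dX A rv"
  then consider a where "a \<in> A" "e = DE (uedge rv a)" | u where "u \<in> X" "e = DL u"
    by (auto simp: deformed_edges_def uedges_def)
  then show "\<exists>x\<in>X. \<exists>y\<in>X. dends org tgt e = {x, y}"
  proof cases
    case 1
    then show ?thesis using dends_uedge arc(1,2) by blast
  qed auto
qed (use assms finite_X in auto)

lemma incident_edges:
  assumes "u \<in> X - dX"
  shows "{e \<in> deformed_edges X dX A rv. u \<in> dends org tgt e}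
    = insert (DL u) ((\<lambda>a. DE (uedge rv a)) ` {a \<in> A. tgt a = u})"
proof (intro equalityI subsetI)
  fix e assume e: "e \<in> {e \<in> deformed_edges X dX A rv. u \<in> dends org tgt e}"
  then consider a where "a \<in> A" "e = DE (uedge rv a)" | v where "e = DL v"
    by (auto simp: deformed_edges_def uedges_def)
  then show "e \<in> insert (DL u) ((\<lambda>a. DE (uedge rv a)) ` {a \<in> A. tgt a = u})"
  proof cases
    case 1
    then have "u = tgt a \<or> u = org a" using e dends_uedge by auto
    \<comment> \<open>If \<open>u\<close> is the origin of the arc, the inverse arc represents the
      same edge and ends at \<open>u\<close>.\<close>
    moreover have "uedge rv (rv a) = uedge rv a" using arc(6)[OF 1(1)] by (auto simp: uedge_def)
    then have "e = DE (uedge rv (rv a))" using 1 by simp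
    ultimately show ?thesis using 1 arc[OF 1(1)] by blast
  qed (use e in auto)
next
  fix e assume e: "e \<in> insert (DL u) ((\<lambda>a. DE (uedge rv a)) ` {a \<in> A. tgt a = u})"
  then show "e \<in> {e \<in> deformed_edges X dX A rv. u \<in> dends org tgt e}"
    using assms dends_uedge by (auto simp: deformed_edges_def uedges_def simp del: dends.simps(1))
qed

text \<open>Off the diagonal the sign in the weight and the sign in \<open>fmat\<close> cancel; on
  the diagonal the edges add up to \<open>jsign J\<close> times \<open>piw\<close>, which the loop
  weight removes. The map inside \<open>fmat\<close> is constant because only row \<open>u\<close>
  is evaluated.\<close>

lemma boundary_matrix_row:
  assumes u: "u \<in> X - dX"
  shows "MV A org tgt rv w V u v - (if u = v then z else 0) =
    (\<Sum>e\<in>{e \<in> deformed_edges X dX A rv. u \<in> dends org tgt e}.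
      wJ J A tgt rv w V z e * fmat (jsign J) (\<lambda>_. other_end (dends org tgt) e u) u v)"
    (is "_ = sum ?g _")
proof -
  let ?T = "{a \<in> A. tgt a = u}"
  \<comment> \<open>Different arcs ending at \<open>u\<close> support different edges, since inverse
    arcs have different termini; parallel edges stay separate summands.\<close>
  have inj: "inj_on (\<lambda>a. DE (uedge rv a) :: ('v, 'a) dedge) ?T"
  proof (rule inj_onI)
    fix a b assume ab: "a \<in> ?T" "b \<in> ?T" "DE (uedge rv a) = (DE (uedge rv b) :: ('v, 'a) dedge)"
    then have "a = b \<or> a = rv b" by (auto simp: uedge_def doubleton_eq_iff)
    then show "a = b" using ab arc(5,7)[of b] by auto
  qed
  have other: "other_end (dends org tgt) (DE (uedge rv a)) u = org a" if "a \<in> ?T" for a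
    using dends_uedge[of a] that by (intro other_end_eq) auto
  have loop: "other_end (dends org tgt) (DL u) u = u" by (intro other_end_eq) simp
  have "sum ?g {e \<in> deformed_edges X dX A rv. u \<in> dends org tgt e} =
      ?g (DL u) + (\<Sum>a\<in>?T. ?g (DE (uedge rv a)))"
    unfolding incident_edges[OF u] using finite_A inj
    by (subst sum.insert) (auto simp: sum.reindex)
  also have "\<dots> = wJ J A tgt rv w V z (DL u) * (if v = u then 1 else 0) +
      (\<Sum>a\<in>?T. jsign J * w (uedge rv a) * (if v = u then 1 else if v = org a then jsign J else 0))"
    by (intro arg_cong2[where f = "(+)"] sum.cong refl) (cases J; simp add: other loop fmat_def)+
  also have "\<dots> = MV A org tgt rv w V u v - (if u = v then z else 0)"
  proof (cases "v = u")
    case True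
    have "{a \<in> A. tgt a = u \<and> org a = u} = {}" using arc(7) by auto
    then have "MV A org tgt rv w V u u = V u" by (simp only: MV_def) simp
    then show ?thesis using True by (cases J) (simp_all add: piw_def sum_negf)
  next
    case False
    have "(\<Sum>a\<in>?T. jsign J * w (uedge rv a) * (if v = u then 1 else if v = org a then jsign J else 0))
        = (\<Sum>a\<in>?T. if org a = v then w (uedge rv a) else 0)"
      using False by (intro sum.cong) (cases J; auto)+
    also have "\<dots> = (\<Sum>a\<in>{a \<in> ?T. org a = v}. w (uedge rv a))"
      using finite_A by (intro sum.inter_filter[symmetric]) simp
    also have "{a \<in> ?T. org a = v} = {a \<in> A. tgt a = u \<and> org a = v}" by auto
    finally show ?thesis using False by (simp add: MV_def)
  qed
  finally show ?thesis by simp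
qed

lemma iota_weight:
  "(case J of JL \<Rightarrow> 1 | JQ \<Rightarrow> 4 ^ bnum X org tgt H) = (4 ^ long_cycles J (dends org tgt) X H :: complex)"
  by (cases J) (simp_all add: bnum_def long_cycles_def)

lemma iota1_eq_det_on:
  assumes dX: "dX \<subseteq> X"
  shows "iota1 J X dX A org tgt rv w V z = det_on X (boundary_matrix X dX A org tgt rv w V z)"
    (is "_ = det_on X ?N")
proof -
  let ?ends = "dends org tgt" and ?E = "deformed_edges X dX A rv" and ?wt = "wJ J A tgt rv w V z"
  interpret rooted_graph ?ends X dX ?E using rooted_graph_deformed[OF dX] .
  have "det_on X ?N = (\<Sum>f\<in>choices ?ends (X - dX) ?E. (\<Prod>u\<in>X - dX. ?wt (f u)) *
      det_on X (\<lambda>u. if u \<in> X - dX then fmat (jsign J) (\<lambda>_. other_end ?ends (f u) u) u else ?N u))"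
    unfolding choices_def using finX finE boundary_matrix_row[of _ dX _ J]
    by (intro det_on_expand_rows) (auto simp: boundary_matrix_def)
  also have "\<dots> = (\<Sum>f\<in>choices ?ends (X - dX) ?E. (\<Prod>u\<in>X - dX. ?wt (f u)) *
      (1 * det_on X (fmat (jsign J) (succ_map ?ends (X - dX) f))))"
    \<comment> \<open>The boundary rows are unit rows, which is what \<open>fmat\<close> has at the
      fixed points of the successor map.\<close>
    by (intro sum.cong refl arg_cong2[where f = "(*)"], simp, intro det_on_cong)
       (auto simp: fmat_def succ_map_def boundary_matrix_def unit_row_def)
  also have "\<dots> = (\<Sum>H\<in>rooted_family J ?ends X dX ?E. 4 ^ long_cycles J ?ends X H * 1 * (\<Prod>e\<in>H. ?wt e))"
    by (rule sum_choices[where \<psi> = "\<lambda>_. 1"]) simp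
  also have "\<dots> = iota1 J X dX A org tgt rv w V z"
    by (simp add: iota1_def HJ1_eq_rooted_family iota_weight WJ_def)
  finally show ?thesis by simp
qed

text \<open>The component of \<open>m\<close> is a tree, so the loop at \<open>m\<close> cannot
  occur, and removing it from the edge set turns \<open>m\<close> into a further root. Conversely, a
  component with root \<open>m\<close> has only this root, hence no boundary vertex.\<close>

lemma HJ2_eq:
  assumes dX: "dX \<subseteq> X" and l: "l \<in> X - dX" and m: "m \<in> X - dX"
  shows "HJ2 J X dX A org tgt rv l m =
    {H \<in> rooted_family J (dends org tgt) X (insert m dX) (deformed_edges X (insert m dX) A rv).
       l \<in> comp_of (dends org tgt) X H m}" (is "_ = {H \<in> ?RF. _}")
proof (intro equalityI subsetI)
  let ?ends = "dends org tgt"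
  fix H assume "H \<in> HJ2 J X dX A org tgt rv l m"
  then have HE: "H \<subseteq> deformed_edges X dX A rv"
    and H: "\<And>W. W \<in> components ?ends X H \<Longrightarrow>
        (W \<inter> dX \<noteq> {} \<longrightarrow> card (W \<inter> dX) = 1 \<and> l \<notin> W \<and> m \<notin> W \<and> is_tree ?ends W (comp_edges ?ends H W))
      \<and> (l \<in> W \<or> m \<in> W \<longrightarrow> l \<in> W \<and> m \<in> W \<and> W \<inter> dX = {} \<and> is_tree ?ends W (comp_edges ?ends H W))
      \<and> (W \<inter> dX = {} \<and> l \<notin> W \<and> m \<notin> W \<longrightarrow> Jcond J ?ends W (comp_edges ?ends H W))"
    unfolding HJ2_def by blast+
  let ?W = "comp_of ?ends X H m"
  have W: "?W \<in> components ?ends X H" "m \<in> ?W" using m comp_of_self by (auto simp: components_eq)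
  have "DL m \<notin> H"
  proof
    assume "DL m \<in> H"
    then have "DL m \<in> comp_edges ?ends H ?W" using W(2) by (simp add: comp_edges_def)
    then have "is_cycle ?ends (comp_edges ?ends H ?W) {DL m}" by (intro is_cycle_loop) auto
    then show False using H[OF W(1)] W(2) by (auto simp: is_tree_def)
  qed
  then have HE': "H \<subseteq> deformed_edges X (insert m dX) A rv" using HE by (auto simp: deformed_edges_def)
  have "H \<in> ?RF" unfolding rooted_family_def
  proof (intro CollectI conjI HE' ballI)
    fix W assume W: "W \<in> components ?ends X H"
    show "W \<inter> insert m dX \<noteq> {} \<longrightarrow> card (W \<inter> insert m dX) = 1 \<and> is_tree ?ends W (comp_edges ?ends H W)"
    proof (cases "m \<in> W")
      case True
      then have "W \<inter> dX = {}" using H[OF W] by blast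
      then have "W \<inter> insert m dX = {m}" using True by blast
      then show ?thesis using H[OF W] True by simp
    next
      case False
      then have eq: "W \<inter> insert m dX = W \<inter> dX" by auto
      show ?thesis unfolding eq using H[OF W] by blast
    qed
    show "W \<inter> insert m dX = {} \<longrightarrow> Jcond J ?ends W (comp_edges ?ends H W)"
    proof
      assume "W \<inter> insert m dX = {}"
      then have "m \<notin> W" "W \<inter> dX = {}" by auto
      moreover from this have "l \<notin> W" using H[OF W] by blast
      ultimately show "Jcond J ?ends W (comp_edges ?ends H W)" using H[OF W] by blast
    qed
  qed
  moreover have "l \<in> ?W" using H[OF W(1)] W(2) by blast
  ultimately show "H \<in> {H \<in> ?RF. l \<in> comp_of ?ends X H m}" by simp
next
  let ?ends = "dends org tgt"
  fix H assume "H \<in> {H \<in> ?RF. l \<in> comp_of ?ends X H m}"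
  then have HE: "H \<subseteq> deformed_edges X (insert m dX) A rv" and lm: "l \<in> comp_of ?ends X H m"
    and H: "\<And>W. W \<in> components ?ends X H \<Longrightarrow>
        (W \<inter> insert m dX \<noteq> {} \<longrightarrow> card (W \<inter> insert m dX) = 1 \<and> is_tree ?ends W (comp_edges ?ends H W))
      \<and> (W \<inter> insert m dX = {} \<longrightarrow> Jcond J ?ends W (comp_edges ?ends H W))"
    unfolding rooted_family_def by blast+
  have both: "m \<in> W \<longleftrightarrow> l \<in> W" if W: "W \<in> components ?ends X H" for W
  proof
    assume "m \<in> W" then show "l \<in> W" using component_eq_comp_of(1)[OF W] lm by simp
  next
    assume "l \<in> W"
    then have "W = comp_of ?ends X H m" using component_eq_comp_of(1)[OF W] comp_of_eq[OF lm] by simp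
    then show "m \<in> W" using m comp_of_self[of m X ?ends H] by simp
  qed
  show "H \<in> HJ2 J X dX A org tgt rv l m" unfolding HJ2_def
  proof (intro CollectI conjI ballI)
    show "H \<subseteq> deformed_edges X dX A rv" using HE by (auto simp: deformed_edges_def)
    fix W assume W: "W \<in> components ?ends X H"
    have no_dX: "W \<inter> dX = {} \<and> is_tree ?ends W (comp_edges ?ends H W)" if mW: "m \<in> W"
    proof -
      have "card (W \<inter> insert m dX) = 1" "is_tree ?ends W (comp_edges ?ends H W)" using H[OF W] mW by auto
      then obtain x where "W \<inter> insert m dX = {x}" by (metis card_1_singletonE)
      then have "W \<inter> insert m dX = {m}" using mW by auto
      then show ?thesis using m \<open>is_tree _ _ _\<close> by auto
    qed
    have dX_only: "W \<inter> insert m dX = W \<inter> dX" if "m \<notin> W" using that by auto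
    show "W \<inter> dX \<noteq> {} \<longrightarrow> card (W \<inter> dX) = 1 \<and> l \<notin> W \<and> m \<notin> W \<and> is_tree ?ends W (comp_edges ?ends H W)"
      using no_dX dX_only H[OF W] both[OF W] by auto
    show "l \<in> W \<or> m \<in> W \<longrightarrow> l \<in> W \<and> m \<in> W \<and> W \<inter> dX = {} \<and> is_tree ?ends W (comp_edges ?ends H W)"
      using no_dX both[OF W] by auto
    show "W \<inter> dX = {} \<and> l \<notin> W \<and> m \<notin> W \<longrightarrow> Jcond J ?ends W (comp_edges ?ends H W)"
      using dX_only H[OF W] by auto
  qed
qed

text \<open>The replaced row \<open>m\<close> is not expanded, so \<open>m\<close> chooses no edge
  and acts as a root.\<close>

lemma iota2_eq_det_on:
  assumes dX: "dX \<subseteq> X" and l: "l \<in> X - dX" and m: "m \<in> X - dX"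
  shows "iota2 J X dX A org tgt rv w V z l m =
    det_on X ((boundary_matrix X dX A org tgt rv w V z)(m := unit_row l))" (is "_ = det_on X (?N(m := _))")
proof -
  let ?ends = "dends org tgt" and ?R = "insert m dX" and ?wt = "wJ J A tgt rv w V z"
  let ?E = "deformed_edges X ?R A rv"
  let ?N' = "?N(m := unit_row l)"
  have RX: "?R \<subseteq> X" using dX m by blast
  interpret rooted_graph ?ends X ?R ?E using rooted_graph_deformed[OF RX] .
  let ?F = "choices ?ends (X - ?R) ?E" and ?p = "succ_map ?ends (X - ?R)"
  let ?\<phi> = "\<lambda>f. if \<exists>k. (?p f ^^ k) l = m then (- jsign J) ^ (LEAST k. (?p f ^^ k) l = m) else 0"
  let ?\<psi> = "\<lambda>H. if l \<in> comp_of ?ends X H m then (- jsign J) ^ gdist ?ends H l m else 0"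
  have row: "?N' u v = (\<Sum>e\<in>{e \<in> ?E. u \<in> ?ends e}. ?wt e * fmat (jsign J) (\<lambda>_. other_end ?ends e u) u v)"
    if "u \<in> X - ?R" for u v
    using boundary_matrix_row[OF that, of v J] that by (simp add: boundary_matrix_def)
  have "det_on X ?N' = (\<Sum>f\<in>?F. (\<Prod>u\<in>X - ?R. ?wt (f u)) *
      det_on X (\<lambda>u. if u \<in> X - ?R then fmat (jsign J) (\<lambda>_. other_end ?ends (f u) u) u else ?N' u))"
    unfolding choices_def using finX finE by (intro det_on_expand_rows row) auto
  also have "\<dots> = (\<Sum>f\<in>?F. (\<Prod>u\<in>X - ?R. ?wt (f u)) * det_on X ((fmat (jsign J) (?p f))(m := unit_row l)))"
    by (intro sum.cong refl arg_cong2[where f = "(*)"] det_on_cong)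
       (auto simp: fmat_def succ_map_def boundary_matrix_def unit_row_def)
  also have "\<dots> = (\<Sum>f\<in>?F. (\<Prod>u\<in>X - ?R. ?wt (f u)) * (?\<phi> f * det_on X (fmat (jsign J) (?p f))))"
  proof (intro sum.cong refl arg_cong2[where f = "(*)"])
    fix f assume f: "f \<in> ?F"
    have "det_on X ((fmat (jsign J) (?p f))(m := unit_row l)) =
        (if \<exists>k. (?p f ^^ k) l = m then (- jsign J) ^ (LEAST k. (?p f ^^ k) l = m) * det_on X (fmat (jsign J) (?p f)) else 0)"
      using finX succ_map_image[OF f] l m by (intro det_on_fmat_replace) (auto simp: succ_map_def)
    then show "det_on X ((fmat (jsign J) (?p f))(m := unit_row l)) = ?\<phi> f * det_on X (fmat (jsign J) (?p f))"
      by (simp split: if_splits)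
  qed
  also have "\<dots> = (\<Sum>H\<in>rooted_family J ?ends X ?R ?E. 4 ^ long_cycles J ?ends X H * ?\<psi> H * (\<Prod>e\<in>H. ?wt e))"
    by (rule sum_choices[where \<psi> = ?\<psi>]) (rule root_walk_sign, use l in auto)
  also have "\<dots> = (\<Sum>H\<in>HJ2 J X dX A org tgt rv l m.
      4 ^ long_cycles J ?ends X H * (- jsign J) ^ gdist ?ends H l m * (\<Prod>e\<in>H. ?wt e))"
    unfolding HJ2_eq[OF dX l m]
  \<comment> \<open>Subgraphs in which \<open>l\<close> lies outside the component of
    \<open>m\<close> carry the factor 0.\<close>
  proof (rule sum.mono_neutral_cong_right)
    show "finite (rooted_family J ?ends X ?R ?E)"
      by (rule finite_subset[of _ "Pow ?E"]) (auto simp: rooted_family_def finE)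
  qed auto
  also have "\<dots> = iota2 J X dX A org tgt rv w V z l m"
    unfolding iota2_def WJ_def iota_weight[symmetric]
    \<comment> \<open>For L the base \<open>- jsign J\<close> is 1, so the distance sign disappears;
      for Q it is -1.\<close>
    by (intro sum.cong refl) (cases J; simp)
  finally show ?thesis by simp
qed

end

theorem mainTheorem1:
  fixes X dX :: "'v set" and A :: "'a set" and org tgt :: "'a \<Rightarrow> 'v" and rv :: "'a \<Rightarrow> 'a"
    and w :: "'a set \<Rightarrow> complex" and V :: "'v \<Rightarrow> complex" and z :: complex
    and G :: "'v \<Rightarrow> 'v \<Rightarrow> complex"
  assumes graph: "symmetric_digraph X A org tgt rv"
    and bdry: "dX \<subset> X"
    and inv_right: "\<forall>u \<in> X - dX. \<forall>v \<in> X - dX.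
        (\<Sum>x \<in> X - dX. (MV A org tgt rv w V u x - (if u = x then z else 0)) * G x v)
          = (if u = v then 1 else 0)"
    and inv_left: "\<forall>u \<in> X - dX. \<forall>v \<in> X - dX.
        (\<Sum>x \<in> X - dX. G u x * (MV A org tgt rv w V x v - (if x = v then z else 0)))
          = (if u = v then 1 else 0)"
  shows "iota1 JL X dX A org tgt rv w V z \<noteq> 0 \<and> iota1 JQ X dX A org tgt rv w V z \<noteq> 0
    \<and> (\<forall>ul \<in> X - dX. \<forall>um \<in> X - dX.
         G ul um = iota2 JL X dX A org tgt rv w V z ul um / iota1 JL X dX A org tgt rv w V z
       \<and> G ul um = iota2 JQ X dX A org tgt rv w V z ul um / iota1 JQ X dX A org tgt rv w V z)"
proof -
  let ?N = "boundary_matrix X dX A org tgt rv w V z"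
  have fin: "finite X" using graph by (simp add: symmetric_digraph_def)
  have dX: "dX \<subseteq> X" using bdry by blast
  \<comment> \<open>the inverse of the block triangular matrix with blocks N, B and 0, I is G, -GB and 0, I\<close>
  define K where "K u v = (if u \<in> X - dX then if v \<in> X - dX then G u v
    else - (\<Sum>x\<in>X - dX. G u x * ?N x v) else unit_row u v)" for u v
  have split: "sum g X = sum g (X - dX) + sum g dX" for g :: "'v \<Rightarrow> complex"
    using fin dX by (metis sum.subset_diff)
  \<comment> \<open>A left inverse on all of \<open>X\<close>, boundary included; it agrees with
    \<open>G\<close> on the interior, where the quotient is finally read off.\<close>
  have inv: "(\<Sum>x\<in>X. K u x * ?N x v) = unit_row u v" if "u \<in> X" "v \<in> X" for u v
  proof (cases "u \<in> X - dX")
    case True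
    have "(\<Sum>x\<in>dX. K u x * ?N x v) = (\<Sum>x\<in>dX. if x = v then K u v else 0)"
      by (intro sum.cong) (auto simp: boundary_matrix_def unit_row_def)
    also have "\<dots> = (if v \<in> dX then K u v else 0)"
      using finite_subset[OF dX fin] by simp
    finally have bd: "(\<Sum>x\<in>dX. K u x * ?N x v) = (if v \<in> dX then K u v else 0)" .
    have int: "(\<Sum>x\<in>X - dX. K u x * ?N x v) = (\<Sum>x\<in>X - dX. G u x * ?N x v)"
      using True by (intro sum.cong) (auto simp: K_def)
    show ?thesis
    proof (cases "v \<in> dX")
      case v: True
      then show ?thesis unfolding split bd int using True by (auto simp: K_def unit_row_def)
    next
      case False
      have "(\<Sum>x\<in>X - dX. G u x * ?N x v) = (\<Sum>x\<in>X - dX. G u x * (MV A org tgt rv w V x v - (if x = v then z else 0)))"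
        by (intro sum.cong) (auto simp: boundary_matrix_def)
      also have "\<dots> = unit_row u v" using inv_left True False that by (auto simp: unit_row_def)
      finally show ?thesis unfolding split bd int using False by simp
    qed
  next
    case False
    have "(\<Sum>x\<in>X. K u x * ?N x v) = (\<Sum>x\<in>X. if x = u then ?N u v else 0)"
      using False by (intro sum.cong) (auto simp: K_def unit_row_def)
    then show ?thesis using False fin that by (simp add: boundary_matrix_def)
  qed
  have ne: "iota1 J X dX A org tgt rv w V z \<noteq> 0" for J
    unfolding iota1_eq_det_on[OF graph dX] using cramer_row(1)[OF fin inv] .
  moreover have "G l m = iota2 J X dX A org tgt rv w V z l m / iota1 J X dX A org tgt rv w V z"
    if "l \<in> X - dX" "m \<in> X - dX" for l m J
  proof -
    have "iota2 J X dX A org tgt rv w V z l m = K l m * iota1 J X dX A org tgt rv w V z"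
      unfolding iota1_eq_det_on[OF graph dX] iota2_eq_det_on[OF graph dX that]
      using that by (intro cramer_row(2)[OF fin inv]) auto
    then show ?thesis using ne[of J] that by (simp add: K_def)
  qed
  ultimately show ?thesis by blast
qed

end
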